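(* Let $p$ be a prime and $1<r<\infty$. For any $f\in\mathrm{Ces}_r(\mathbb{Q}_p)$, $$\|\mathscr{H}f\|_{\mathrm{Ces}_r(\mathbb{Q}_p)}\le C_{p,r}\,\|f\|_{\mathrm{Ces}_r(\mathbb{Q}_p)},$$ where $\mathscr{H}$ is the $p$-adic Hilbert operator $$\mathscr{H}f(x)=\int_{\mathbb{Q}_p^*}\frac{f(y)}{|x|_p+|y|_p}\,dy,\qquad x\in\mathbb{Q}_p^*,$$ and $$C_{p,r}=(1-p^{-1})\sum_{j\in\mathbb{Z}}\frac{p^{j(1-1/r)}}{1+p^j}.$$
   Context: $\mathbb{Q}_p$ is the field of $p$-adic numbers with absolute value $|\cdot|_p$ normalized by $|p|_p=p^{-1}$, and $\mathbb{Q}_p^*=\mathbb{Q}_p\setminus\{0\}$. $dx$ is the additive Haar measure on $\mathbb{Q}_p$ normalized so that $\{x:|x|_p\le 1\}$ has measure $1$. For $1\le r<\infty$, the $p$-adic Cesàro function space $\mathrm{Ces}_r(\mathbb{Q}_p)$ consists of all measurable functions $f$ on $\mathbb{Q}_p$ with $$\|f\|_{\mathrm{Ces}_r(\mathbb{Q}_p)}=\left(\int_{\mathbb{Q}_p}\left(\frac{1}{|x|_p}\int_{|y|_p\le|x|_p}|f(y)|\,dy\right)^r dx\right)^{1/r}<\infty.$$ *)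

theory Defs
  imports
    "HOL-Analysis.Analysis"
    "HOL-Computational_Algebra.Primes"
    "Berlekamp_Zassenhaus.Finite_Field"
begin

section \<open>The \<open>p\<close>-adic absolute value on the rationals\<close>

definition padic_abs_rat :: "nat \<Rightarrow> rat \<Rightarrow> real" where
  "padic_abs_rat p q =
     (if q = 0 then 0
      else real p powi (int (multiplicity (int p) (snd (quotient_of q)))
                        - int (multiplicity (int p) (fst (quotient_of q)))))"

definition padic_null :: "nat \<Rightarrow> (nat \<Rightarrow> rat) \<Rightarrow> bool" where
  "padic_null p X \<longleftrightarrow> (\<lambda>n. padic_abs_rat p (X n)) \<longlonglongrightarrow> 0"

definition padic_cauchy :: "nat \<Rightarrow> (nat \<Rightarrow> rat) \<Rightarrow> bool" where
  "padic_cauchy p X \<longleftrightarrow> (\<forall>e>0. \<exists>N. \<forall>m\<ge>N. \<forall>n\<ge>N. padic_abs_rat p (X m - X n) < e)"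

definition padic_rel :: "nat \<Rightarrow> (nat \<Rightarrow> rat) \<Rightarrow> (nat \<Rightarrow> rat) \<Rightarrow> bool" where
  "padic_rel p X Y \<longleftrightarrow> padic_cauchy p X \<and> padic_cauchy p Y \<and> padic_null p (\<lambda>n. X n - Y n)"

context
  fixes p :: nat
  assumes p: "prime p"
begin

lemma prime_elem_p: "prime_elem (int p)"
  using p by (simp add: prime_imp_prime_elem)

lemma p_gt_1: "real p > 1"
  using p prime_gt_1_nat by simp

lemma padic_abs_rat_0 [simp]: "padic_abs_rat p 0 = 0"
  by (simp add: padic_abs_rat_def)

lemma padic_abs_rat_Fract:
  assumes "a \<noteq> 0" "b \<noteq> 0"
  shows "padic_abs_rat p (Rat.Fract a b) = real p powi (int (multiplicity (int p) b) - int (multiplicity (int p) a))"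
proof -
  obtain c d where cd: "quotient_of (Rat.Fract a b) = (c, d)" by fastforce
  have d: "d > 0" using cd by (rule quotient_of_denom_pos)
  have eq: "Rat.Fract a b = Rat.Fract c d"
    using quotient_of_div[OF cd] by (simp add: Fract_of_int_quotient)
  have nz: "Rat.Fract a b \<noteq> 0" using assms by (simp add: Zero_rat_def eq_rat)
  have c: "c \<noteq> 0" using nz eq by (auto simp: rat_number_collapse)
  have "a * d = c * b" using eq assms d by (simp add: eq_rat)
  hence "multiplicity (int p) (a * d) = multiplicity (int p) (c * b)" by simp
  hence "multiplicity (int p) a + multiplicity (int p) d = multiplicity (int p) c + multiplicity (int p) b"
    using assms c d prime_elem_p by (simp add: prime_elem_multiplicity_mult_distrib)
  hence *: "int (multiplicity (int p) d) - int (multiplicity (int p) c) =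
      int (multiplicity (int p) b) - int (multiplicity (int p) a)" by linarith
  show ?thesis
    using nz unfolding padic_abs_rat_def cd by (simp add: *)
qed

lemma padic_abs_rat_nonneg [simp]: "padic_abs_rat p q \<ge> 0"
  by (simp add: padic_abs_rat_def)

lemma padic_abs_rat_eq_0_iff [simp]: "padic_abs_rat p q = 0 \<longleftrightarrow> q = 0"
  using p_gt_1 by (simp add: padic_abs_rat_def)

lemma padic_abs_rat_minus [simp]: "padic_abs_rat p (- q) = padic_abs_rat p q"
  by (cases q rule: Rat_cases_nonzero)
     (use multiplicity_times_unit_right[of "-1::int" "int p"] in \<open>auto simp: padic_abs_rat_Fract\<close>)

lemma padic_abs_rat_mult: "padic_abs_rat p (q * s) = padic_abs_rat p q * padic_abs_rat p s"
proof (cases q rule: Rat_cases_nonzero)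
  case q: (Fract a b)
  show ?thesis
  proof (cases s rule: Rat_cases_nonzero)
    case s: (Fract c d)
    show ?thesis using q s prime_elem_p p_gt_1
      by (simp add: padic_abs_rat_Fract prime_elem_multiplicity_mult_distrib algebra_simps
          flip: power_int_add)
  qed simp
qed simp

lemma padic_abs_rat_1 [simp]: "padic_abs_rat p 1 = 1"
  by (simp add: One_rat_def padic_abs_rat_Fract)

lemma padic_abs_rat_inverse: "padic_abs_rat p (inverse q) = inverse (padic_abs_rat p q)"
proof (cases "q = 0")
  case False
  hence "padic_abs_rat p (inverse q) * padic_abs_rat p q = 1"
    by (simp flip: padic_abs_rat_mult)
  thus ?thesis using False by (simp add: field_simps)
qed simp

lemma padic_abs_rat_ultra:
  "padic_abs_rat p (q + s) \<le> max (padic_abs_rat p q) (padic_abs_rat p s)"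
proof (cases "q = 0 \<or> s = 0 \<or> q + s = 0")
  case True
  thus ?thesis by (auto simp: max_def)
next
  case False
  obtain a b where q: "q = Rat.Fract a b" "b > 0" "a \<noteq> 0"
    using False by (cases q rule: Rat_cases_nonzero) auto
  obtain c d where s: "s = Rat.Fract c d" "d > 0" "c \<noteq> 0"
    using False by (cases s rule: Rat_cases_nonzero) auto
  let ?m = "\<lambda>x. multiplicity (int p) x"
  have qs: "q + s = Rat.Fract (a * d + c * b) (b * d)" using q s by simp
  have nz: "a * d + c * b \<noteq> 0" using False qs by (auto simp: rat_number_collapse)
  have "\<not> is_unit (int p)" using prime_elem_p prime_elem_def by blast
  moreover have "int p ^ min (?m (a * d)) (?m (c * b)) dvd a * d + c * b"
    by (intro dvd_add multiplicity_dvd') auto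
  ultimately have "?m (a * d + c * b) \<ge> min (?m (a * d)) (?m (c * b))"
    using nz by (intro multiplicity_geI) auto
  moreover have "?m (a * d) = ?m a + ?m d" "?m (c * b) = ?m c + ?m b" "?m (b * d) = ?m b + ?m d"
    using q s prime_elem_p by (simp_all add: prime_elem_multiplicity_mult_distrib)
  moreover have mono: "mono (\<lambda>k. real p powi k)"
    using p_gt_1 by (intro monoI power_int_increasing) auto
  ultimately have "int (?m (b * d)) - int (?m (a * d + c * b)) \<le>
      max (int (?m b) - int (?m a)) (int (?m d) - int (?m c))"
    by linarith
  hence "real p powi (int (?m (b * d)) - int (?m (a * d + c * b))) \<le>
      real p powi (max (int (?m b) - int (?m a)) (int (?m d) - int (?m c)))"
    using p_gt_1 by (intro power_int_increasing) auto
  also have "\<dots> = max (padic_abs_rat p q) (padic_abs_rat p s)"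
    using q s mono by (simp add: padic_abs_rat_Fract max_of_mono[OF mono])
  finally show ?thesis using q s nz unfolding qs by (simp add: padic_abs_rat_Fract)
qed

lemma padic_abs_rat_triangle: "padic_abs_rat p (q + s) \<le> padic_abs_rat p q + padic_abs_rat p s"
  using padic_abs_rat_ultra[of q s] padic_abs_rat_nonneg[of q] padic_abs_rat_nonneg[of s]
  by linarith

lemma padic_abs_rat_commute: "padic_abs_rat p (q - s) = padic_abs_rat p (s - q)"
  by (metis minus_diff_eq padic_abs_rat_minus)

lemma padic_abs_rat_triangle3: "\<bar>padic_abs_rat p q - padic_abs_rat p s\<bar> \<le> padic_abs_rat p (q - s)"
  using padic_abs_rat_triangle[of "q - s" s] padic_abs_rat_triangle[of "s - q" q]
    padic_abs_rat_commute[of q s] by simp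

lemma padic_null_add:
  assumes "padic_null p X" "padic_null p Y" shows "padic_null p (\<lambda>n. X n + Y n)"
  unfolding padic_null_def
proof (rule Lim_null_comparison)
  show "(\<lambda>n. padic_abs_rat p (X n) + padic_abs_rat p (Y n)) \<longlonglongrightarrow> 0"
    using tendsto_add[OF assms[unfolded padic_null_def]] by simp
qed (use padic_abs_rat_triangle in auto)

lemma padic_null_minus_iff: "padic_null p (\<lambda>n. - X n) \<longleftrightarrow> padic_null p X"
  by (simp add: padic_null_def)

lemma padic_null_commute: "padic_null p (\<lambda>n. X n - Y n) \<longleftrightarrow> padic_null p (\<lambda>n. Y n - X n)"
  by (simp add: padic_null_def padic_abs_rat_commute)

lemma padic_null_const [simp]: "padic_null p (\<lambda>n. c) \<longleftrightarrow> c = 0"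
  by (simp add: padic_null_def tendsto_const_iff)

lemma padic_cauchy_const [simp]: "padic_cauchy p (\<lambda>n. c)"
  by (simp add: padic_cauchy_def)

lemma padic_cauchyD: "padic_cauchy p X \<Longrightarrow> e > 0 \<Longrightarrow> \<exists>N. \<forall>m\<ge>N. \<forall>n\<ge>N. padic_abs_rat p (X m - X n) < e"
  by (simp add: padic_cauchy_def)

lemma padic_cauchy_add:
  assumes "padic_cauchy p X" "padic_cauchy p Y" shows "padic_cauchy p (\<lambda>n. X n + Y n)"
  unfolding padic_cauchy_def
proof (intro allI impI)
  fix e :: real assume "e > 0"
  obtain M where M: "\<forall>m\<ge>M. \<forall>n\<ge>M. padic_abs_rat p (X m - X n) < e"
    using padic_cauchyD[OF assms(1) \<open>e > 0\<close>] by blast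
  obtain N where N: "\<forall>m\<ge>N. \<forall>n\<ge>N. padic_abs_rat p (Y m - Y n) < e"
    using padic_cauchyD[OF assms(2) \<open>e > 0\<close>] by blast
  have "padic_abs_rat p (X m + Y m - (X n + Y n)) < e" if "m \<ge> max M N" "n \<ge> max M N" for m n
  proof -
    have "max (padic_abs_rat p (X m - X n)) (padic_abs_rat p (Y m - Y n)) < e"
      using M N that by simp
    thus ?thesis using padic_abs_rat_ultra[of "X m - X n" "Y m - Y n"]
      unfolding add_diff_add by linarith
  qed
  thus "\<exists>N. \<forall>m\<ge>N. \<forall>n\<ge>N. padic_abs_rat p (X m + Y m - (X n + Y n)) < e" by blast
qed

lemma padic_cauchy_minus:
  assumes "padic_cauchy p X" shows "padic_cauchy p (\<lambda>n. - X n)"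
  using assms unfolding padic_cauchy_def minus_diff_minus padic_abs_rat_minus .

lemma padic_cauchy_diff:
  assumes "padic_cauchy p X" "padic_cauchy p Y" shows "padic_cauchy p (\<lambda>n. X n - Y n)"
  using padic_cauchy_add[OF assms(1) padic_cauchy_minus[OF assms(2)]] by simp

lemma padic_cauchy_abs_convergent:
  assumes "padic_cauchy p X" shows "convergent (\<lambda>n. padic_abs_rat p (X n))"
proof -
  have "Cauchy (\<lambda>n. padic_abs_rat p (X n))"
    unfolding Cauchy_def dist_real_def
    using assms padic_abs_rat_triangle3 unfolding padic_cauchy_def
    by (meson order_le_less_trans)
  thus ?thesis by (rule Cauchy_convergent)
qed

lemma padic_cauchy_bounded:
  assumes "padic_cauchy p X" obtains B where "B > 0" "\<And>n. padic_abs_rat p (X n) \<le> B"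
proof -
  have "Bseq (\<lambda>n. padic_abs_rat p (X n))"
    using padic_cauchy_abs_convergent[OF assms] by (rule convergent_imp_Bseq)
  then obtain B where "B > 0" "\<And>n. norm (padic_abs_rat p (X n)) \<le> B" by (auto elim: BseqE)
  thus ?thesis using that by auto
qed

lemma padic_null_mult_cauchy:
  assumes "padic_cauchy p X" "padic_null p Y" shows "padic_null p (\<lambda>n. X n * Y n)"
  using tendsto_mult[OF convergent_LIMSEQ_iff[THEN iffD1, OF padic_cauchy_abs_convergent[OF assms(1)]]
      assms(2)[unfolded padic_null_def]]
  by (simp add: padic_null_def padic_abs_rat_mult)

lemma padic_cauchy_mult:
  assumes "padic_cauchy p X" "padic_cauchy p Y" shows "padic_cauchy p (\<lambda>n. X n * Y n)"
  unfolding padic_cauchy_def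
proof (intro allI impI)
  fix e :: real assume "e > 0"
  obtain A where A: "A > 0" "\<And>n. padic_abs_rat p (X n) \<le> A"
    using padic_cauchy_bounded[OF assms(1)] by blast
  obtain B where B: "B > 0" "\<And>n. padic_abs_rat p (Y n) \<le> B"
    using padic_cauchy_bounded[OF assms(2)] by blast
  obtain M where M: "\<forall>m\<ge>M. \<forall>n\<ge>M. padic_abs_rat p (X m - X n) < e / B"
    using padic_cauchyD[OF assms(1), of "e / B"] \<open>e > 0\<close> B by auto
  obtain N where N: "\<forall>m\<ge>N. \<forall>n\<ge>N. padic_abs_rat p (Y m - Y n) < e / A"
    using padic_cauchyD[OF assms(2), of "e / A"] \<open>e > 0\<close> A by auto
  have "padic_abs_rat p (X m * Y m - X n * Y n) < e" if "m \<ge> max M N" "n \<ge> max M N" for m n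
  proof -
    have "padic_abs_rat p (X m * (Y m - Y n)) \<le> A * padic_abs_rat p (Y m - Y n)"
      unfolding padic_abs_rat_mult by (intro mult_right_mono A) auto
    also have "\<dots> < A * (e / A)" using N A that by (intro mult_strict_left_mono) auto
    finally have 1: "padic_abs_rat p (X m * (Y m - Y n)) < e" using A by simp
    have "padic_abs_rat p ((X m - X n) * Y n) \<le> padic_abs_rat p (X m - X n) * B"
      unfolding padic_abs_rat_mult by (intro mult_left_mono B) auto
    also have "\<dots> < (e / B) * B" using M B that by (intro mult_strict_right_mono) auto
    finally have 2: "padic_abs_rat p ((X m - X n) * Y n) < e" using B by simp
    have "X m * Y m - X n * Y n = X m * (Y m - Y n) + (X m - X n) * Y n"
      by (simp add: algebra_simps)
    thus ?thesis using padic_abs_rat_ultra[of "X m * (Y m - Y n)" "(X m - X n) * Y n"] 1 2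
      by simp
  qed
  thus "\<exists>N. \<forall>m\<ge>N. \<forall>n\<ge>N. padic_abs_rat p (X m * Y m - X n * Y n) < e" by blast
qed

lemma padic_cauchy_lim_pos:
  assumes "padic_cauchy p X" "\<not> padic_null p X"
  obtains L where "L > 0" "(\<lambda>n. padic_abs_rat p (X n)) \<longlonglongrightarrow> L"
    "\<forall>\<^sub>F n in sequentially. padic_abs_rat p (X n) > L / 2"
proof -
  obtain L where L: "(\<lambda>n. padic_abs_rat p (X n)) \<longlonglongrightarrow> L"
    using padic_cauchy_abs_convergent[OF assms(1)] by (auto simp: convergent_def)
  have "L \<ge> 0" using L by (rule LIMSEQ_le_const) auto
  moreover have "L \<noteq> 0" using L assms(2) by (auto simp: padic_null_def)
  ultimately have "L > 0" by simp
  moreover have "\<forall>\<^sub>F n in sequentially. padic_abs_rat p (X n) > L / 2"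
    using L \<open>L > 0\<close> by (intro order_tendstoD) auto
  ultimately show ?thesis using that L by blast
qed

lemma padic_cauchy_nz:
  assumes "padic_cauchy p X" "\<not> padic_null p X"
  shows "\<forall>\<^sub>F n in sequentially. X n \<noteq> 0"
proof -
  obtain L where L: "L > 0" "\<forall>\<^sub>F n in sequentially. padic_abs_rat p (X n) > L / 2"
    using padic_cauchy_lim_pos[OF assms] by metis
  show ?thesis using L(2) by (rule eventually_mono) (use L(1) in auto)
qed

lemma padic_cauchy_inverse:
  assumes "padic_cauchy p X" "\<not> padic_null p X"
  shows "padic_cauchy p (\<lambda>n. inverse (X n))"
  unfolding padic_cauchy_def
proof (intro allI impI)
  fix e :: real assume "e > 0"
  obtain L where L: "L > 0" "\<forall>\<^sub>F n in sequentially. padic_abs_rat p (X n) > L / 2"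
    using padic_cauchy_lim_pos[OF assms] by metis
  then obtain M where M: "\<And>n. n \<ge> M \<Longrightarrow> padic_abs_rat p (X n) > L / 2"
    by (auto simp: eventually_sequentially)
  have "e * (L / 2 * (L / 2)) > 0" using L \<open>e > 0\<close> by simp
  then obtain N where N: "\<forall>m\<ge>N. \<forall>n\<ge>N. padic_abs_rat p (X m - X n) < e * (L / 2 * (L / 2))"
    using padic_cauchyD[OF assms(1)] by blast
  have "padic_abs_rat p (inverse (X m) - inverse (X n)) < e" if "m \<ge> max M N" "n \<ge> max M N" for m n
  proof -
    have m: "padic_abs_rat p (X m) > L / 2" and n: "padic_abs_rat p (X n) > L / 2"
      using M that by auto
    hence nz: "X m \<noteq> 0" "X n \<noteq> 0" using L by auto
    have "padic_abs_rat p (inverse (X m) - inverse (X n)) =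
        padic_abs_rat p (X m - X n) / (padic_abs_rat p (X m) * padic_abs_rat p (X n))"
      unfolding inverse_diff_inverse[OF nz] padic_abs_rat_minus padic_abs_rat_mult padic_abs_rat_inverse
      by (simp add: divide_inverse)
    also have "\<dots> \<le> padic_abs_rat p (X m - X n) / (L / 2 * (L / 2))"
      using m n L by (intro divide_left_mono mult_mono mult_pos_pos) auto
    also have "\<dots> < e" using N that L
      by (subst pos_divide_less_eq) auto
    finally show ?thesis .
  qed
  thus "\<exists>N. \<forall>m\<ge>N. \<forall>n\<ge>N. padic_abs_rat p (inverse (X m) - inverse (X n)) < e" by blast
qed

lemma padic_rel_imp_null_iff:
  assumes "padic_rel p X Y" shows "padic_null p X \<longleftrightarrow> padic_null p Y"
proof -
  have "padic_null p (\<lambda>n. X n - Y n)" "padic_null p (\<lambda>n. Y n - X n)"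
    using assms padic_null_commute[of X Y] by (auto simp: padic_rel_def)
  from this[THEN padic_null_add] show ?thesis
    by (metis (no_types, lifting) ext diff_add_cancel)
qed

lemma padic_null_inverse_diff:
  assumes "padic_rel p X Y" "\<not> padic_null p X"
  shows "padic_null p (\<lambda>n. inverse (X n) - inverse (Y n))"
proof -
  have X: "padic_cauchy p X" and Y: "padic_cauchy p Y" and XY: "padic_null p (\<lambda>n. X n - Y n)"
    and Y0: "\<not> padic_null p Y"
    using assms padic_rel_imp_null_iff by (auto simp: padic_rel_def)
  have "padic_cauchy p (\<lambda>n. - (inverse (X n) * inverse (Y n)))"
    using X Y Y0 assms(2) by (intro padic_cauchy_minus padic_cauchy_mult padic_cauchy_inverse)
  hence *: "padic_null p (\<lambda>n. - (inverse (X n) * inverse (Y n)) * (X n - Y n))"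
    using XY by (rule padic_null_mult_cauchy)
  have "\<forall>\<^sub>F n in sequentially. padic_abs_rat p (- (inverse (X n) * inverse (Y n)) * (X n - Y n)) =
      padic_abs_rat p (inverse (X n) - inverse (Y n))"
    using padic_cauchy_nz[OF X assms(2)] padic_cauchy_nz[OF Y Y0]
    by eventually_elim
       (subst inverse_diff_inverse, assumption, assumption,
        simp only: padic_abs_rat_mult padic_abs_rat_minus mult_ac)
  thus ?thesis using * unfolding padic_null_def by (rule Lim_transform_eventually[rotated])
qed

lemma padic_null_inverse_mult:
  assumes "padic_cauchy p X" "\<not> padic_null p X"
  shows "padic_null p (\<lambda>n. inverse (X n) * X n - 1)"
  unfolding padic_null_def
proof (rule tendsto_eventually)
  show "\<forall>\<^sub>F n in sequentially. padic_abs_rat p (inverse (X n) * X n - 1) = 0"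
    using padic_cauchy_nz[OF assms] by eventually_elim simp
qed

lemma padic_rel_refl: "padic_cauchy p X \<Longrightarrow> padic_rel p X X"
  by (simp add: padic_rel_def)

lemma part_equivp_padic_rel: "part_equivp (padic_rel p)"
proof (rule part_equivpI)
  show "\<exists>X. padic_rel p X X" using padic_rel_refl[OF padic_cauchy_const] by blast
  show "symp (padic_rel p)" unfolding symp_def padic_rel_def using padic_null_commute by blast
  show "transp (padic_rel p)"
  proof (rule transpI)
    fix X Y Z assume *: "padic_rel p X Y" "padic_rel p Y Z"
    have "padic_null p (\<lambda>n. (X n - Y n) + (Y n - Z n))"
      using * by (intro padic_null_add) (simp_all add: padic_rel_def)
    thus "padic_rel p X Z" using * by (simp add: padic_rel_def)
  qed
qed

lemma padic_null_mult_diff: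
  assumes "padic_rel p X X'" "padic_rel p Y Y'"
  shows "padic_null p (\<lambda>n. X n * Y n - X' n * Y' n)"
proof -
  have "padic_null p (\<lambda>n. X n * (Y n - Y' n) + Y' n * (X n - X' n))"
    using assms by (intro padic_null_add padic_null_mult_cauchy) (auto simp: padic_rel_def)
  thus ?thesis by (simp add: algebra_simps)
qed

lemma padic_abs_tendsto_lim:
  "padic_cauchy p X \<Longrightarrow> (\<lambda>n. padic_abs_rat p (X n)) \<longlonglongrightarrow> lim (\<lambda>n. padic_abs_rat p (X n))"
  using padic_cauchy_abs_convergent convergent_LIMSEQ_iff by blast

lemma padic_rel_lim_eq:
  assumes "padic_rel p X Y"
  shows "lim (\<lambda>n. padic_abs_rat p (X n)) = lim (\<lambda>n. padic_abs_rat p (Y n))"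
proof -
  have X: "padic_cauchy p X" and Y: "padic_cauchy p Y" and XY: "padic_null p (\<lambda>n. X n - Y n)"
    using assms by (auto simp: padic_rel_def)
  have "(\<lambda>n. padic_abs_rat p (X n) - padic_abs_rat p (Y n)) \<longlonglongrightarrow> 0"
    by (rule Lim_null_comparison[OF _ XY[unfolded padic_null_def]])
       (auto intro!: always_eventually padic_abs_rat_triangle3)
  moreover have "(\<lambda>n. padic_abs_rat p (X n) - padic_abs_rat p (Y n)) \<longlonglongrightarrow>
      lim (\<lambda>n. padic_abs_rat p (X n)) - lim (\<lambda>n. padic_abs_rat p (Y n))"
    using padic_abs_tendsto_lim[OF X] padic_abs_tendsto_lim[OF Y] by (rule tendsto_diff)
  ultimately show ?thesis using LIMSEQ_unique by fastforce
qed

end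


section \<open>The field of \<open>p\<close>-adic numbers\<close>

text \<open>
  The prime \<open>p\<close> is \<open>CARD('p)\<close>; the type \<open>'p padic\<close> is the completion of the rationals
  with respect to \<open>padic_abs_rat CARD('p)\<close>, i.e. Cauchy sequences modulo null sequences.
\<close>

typedef (overloaded) 'p padic =
  "{X. padic_cauchy CARD('p::prime_card) X} // {(X, Y). padic_rel CARD('p) X Y}"
  morphisms padic_class Abs_padic
  using padic_cauchy_const[OF prime_card] unfolding quotient_def by blast

text \<open>\<open>Padic X\<close> is the class of the Cauchy sequence \<open>X\<close>, i.e. its limit.\<close>

definition Padic :: "(nat \<Rightarrow> rat) \<Rightarrow> 'p::prime_card padic" where
  "Padic X = Abs_padic ({(X, Y). padic_rel CARD('p) X Y} `` {X})"

definition rep_padic :: "'p::prime_card padic \<Rightarrow> nat \<Rightarrow> rat" where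
  "rep_padic x = (SOME X. X \<in> padic_class x)"

definition cr_padic :: "(nat \<Rightarrow> rat) \<Rightarrow> 'p::prime_card padic \<Rightarrow> bool" where
  "cr_padic X x \<longleftrightarrow> padic_rel CARD('p) X X \<and> Padic X = x"

lemma Quotient_padic:
  "Quotient (padic_rel CARD('p)) Padic rep_padic (cr_padic :: _ \<Rightarrow> 'p::prime_card padic \<Rightarrow> bool)"
proof -
  let ?A = "{X. padic_cauchy CARD('p) X}" and ?R = "{(X, Y). padic_rel CARD('p) X Y}"
  have equiv: "equiv ?A ?R"
  proof (rule equivI)
    show "?R \<subseteq> ?A \<times> ?A" by (auto simp: padic_rel_def)
    show "refl_on ?A ?R" by (auto simp: refl_on_def padic_rel_refl prime_card)
    have pe: "part_equivp (padic_rel CARD('p))" by (rule part_equivp_padic_rel[OF prime_card])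
    show "sym ?R"
      using part_equivp_symp[OF pe] by (simp add: sym_def)
    show "trans ?R"
      using part_equivp_transp[OF pe] unfolding trans_def by blast
  qed
  have cl: "padic_class (Padic X :: 'p padic) = ?R `` {X}" if "padic_cauchy CARD('p) X" for X
    unfolding Padic_def using that by (intro Abs_padic_inverse quotientI) auto
  have Abs_Rep: "padic_rel CARD('p) (rep_padic x) (rep_padic x) \<and> Padic (rep_padic x) = x"
    for x :: "'p padic"
  proof -
    obtain X where X: "padic_cauchy CARD('p) X" "padic_class x = ?R `` {X}"
      using padic_class[of x] by (auto elim: quotientE)
    have "X \<in> padic_class x" using X by (auto simp: padic_rel_refl prime_card)
    hence "rep_padic x \<in> padic_class x" unfolding rep_padic_def by (rule someI[of "\<lambda>X. X \<in> padic_class x"])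
    hence *: "(X, rep_padic x) \<in> ?R" using X by auto
    hence "padic_class (Padic (rep_padic x) :: 'p padic) = padic_class x"
      using cl[of "rep_padic x"] equiv_class_eq[OF equiv *] X by (auto simp: padic_rel_def)
    thus ?thesis using * by (auto simp: padic_class_inject padic_rel_refl padic_rel_def prime_card)
  qed
  have "padic_rel CARD('p) X Y \<longleftrightarrow> padic_rel CARD('p) X X \<and> padic_rel CARD('p) Y Y \<and>
      (Padic X :: 'p padic) = Padic Y" for X Y
  proof (cases "padic_cauchy CARD('p) X \<and> padic_cauchy CARD('p) Y")
    case True
    hence "(Padic X :: 'p padic) = Padic Y \<longleftrightarrow> ?R `` {X} = ?R `` {Y}"
      by (simp flip: padic_class_inject add: cl)
    also have "\<dots> \<longleftrightarrow> padic_rel CARD('p) X Y"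
      using eq_equiv_class_iff[OF equiv, of X Y] True by simp
    finally show ?thesis using True by (auto simp: padic_rel_refl prime_card)
  qed (auto simp: padic_rel_def)
  moreover have "(cr_padic :: _ \<Rightarrow> 'p padic \<Rightarrow> bool) = (\<lambda>X x. padic_rel CARD('p) X X \<and> Padic X = x)"
    by (intro ext) (rule cr_padic_def)
  ultimately show ?thesis
    unfolding Quotient_def using Abs_Rep by blast
qed

setup_lifting Quotient_padic

lemma Domainp_pcr_padic [transfer_domain_rule]:
  "Domainp (pcr_padic :: _ \<Rightarrow> 'p::prime_card padic \<Rightarrow> _) = padic_cauchy CARD('p)"
  by (auto simp: padic.domain_eq padic_rel_def prime_card fun_eq_iff)

instantiation padic :: (prime_card) field
begin

lift_definition zero_padic :: "'a padic" is "\<lambda>n. 0"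
  by (intro padic_rel_refl padic_cauchy_const prime_card)

lift_definition one_padic :: "'a padic" is "\<lambda>n. 1"
  by (intro padic_rel_refl padic_cauchy_const prime_card)

lift_definition plus_padic :: "'a padic \<Rightarrow> 'a padic \<Rightarrow> 'a padic" is "\<lambda>X Y n. X n + Y n"
  unfolding padic_rel_def add_diff_add
  by (intro conjI padic_cauchy_add padic_null_add prime_card; blast)

lift_definition uminus_padic :: "'a padic \<Rightarrow> 'a padic" is "\<lambda>X n. - X n"
  unfolding padic_rel_def minus_diff_minus
  by (simp add: padic_cauchy_minus[OF prime_card] padic_null_minus_iff[OF prime_card] del: minus_diff_eq)

lift_definition times_padic :: "'a padic \<Rightarrow> 'a padic \<Rightarrow> 'a padic" is "\<lambda>X Y n. X n * Y n"
proof -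
  fix X X' Y Y' assume *: "padic_rel CARD('a) X X'" "padic_rel CARD('a) Y Y'"
  show "padic_rel CARD('a) (\<lambda>n. X n * Y n) (\<lambda>n. X' n * Y' n)"
    using * padic_null_mult_diff[OF prime_card *]
    by (simp add: padic_rel_def padic_cauchy_mult[OF prime_card])
qed

lift_definition inverse_padic :: "'a padic \<Rightarrow> 'a padic"
  is "\<lambda>X. if padic_null CARD('a) X then (\<lambda>n. 0) else (\<lambda>n. inverse (X n))"
proof -
  fix X Y assume *: "padic_rel CARD('a) X Y"
  note pc = prime_card[where 'a='a]
  show "?thesis X Y"
    using * padic_rel_imp_null_iff[OF pc *] padic_null_inverse_diff[OF pc *]
    by (simp add: padic_rel_def padic_cauchy_inverse[OF pc] padic_cauchy_const[OF pc]
        padic_null_const[OF pc])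
qed

definition minus_padic :: "'a padic \<Rightarrow> 'a padic \<Rightarrow> 'a padic" where "x - y = x + - y" for x y :: "'a padic"

definition divide_padic :: "'a padic \<Rightarrow> 'a padic \<Rightarrow> 'a padic" where "x div y = x * inverse y" for x y :: "'a padic"

instance
proof
  fix a b c :: "'a padic"
  note [simp] = prime_card[where 'a='a]
  note [simp] = padic_rel_refl[OF \<open>prime CARD('a)\<close>] padic_cauchy_const[OF \<open>prime CARD('a)\<close>]
    padic_cauchy_add[OF \<open>prime CARD('a)\<close>] padic_cauchy_mult[OF \<open>prime CARD('a)\<close>]
    padic_cauchy_minus[OF \<open>prime CARD('a)\<close>]
  show "a + b = b + a"
    by transfer (simp add: add.commute)
  show "(a + b) + c = a + (b + c)"
    by transfer (simp add: add.assoc)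
  show "0 + a = a"
    by transfer simp
  show "- a + a = 0"
    by transfer simp
  show "a - b = a + - b"
    by (rule minus_padic_def)
  show "(a * b) * c = a * (b * c)"
    by transfer (simp add: mult.assoc)
  show "a * b = b * a"
    by transfer (simp add: mult.commute)
  show "1 * a = a"
    by transfer simp
  show "(a + b) * c = a * c + b * c"
    by transfer (simp add: distrib_right)
  show "(0::'a padic) \<noteq> 1"
    by transfer (simp add: padic_rel_def)
  show "a \<noteq> 0 \<Longrightarrow> inverse a * a = 1"
    by transfer
       (auto simp: padic_rel_def padic_null_inverse_mult padic_cauchy_inverse)
  show "a div b = a * inverse b"
    by (rule divide_padic_def)
  show "inverse (0::'a padic) = 0"
    by transfer simp
qed

end

lemma minus_padic_transfer [transfer_rule]:
  includes lifting_syntax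
  shows "(pcr_padic ===> pcr_padic ===> (pcr_padic :: _ \<Rightarrow> 'p::prime_card padic \<Rightarrow> _))
           (\<lambda>X Y n. X n - Y n) (-)"
  unfolding minus_padic_def diff_conv_add_uminus by transfer_prover


section \<open>The absolute value and the topology\<close>

text \<open>The absolute value of \<open>x\<close> is the limit of the absolute values of
  any Cauchy sequence of rationals representing \<open>x\<close>.\<close>

lift_definition padic_abs :: "'p::prime_card padic \<Rightarrow> real"
  is "\<lambda>X. lim (\<lambda>n. padic_abs_rat CARD('p) (X n))"
  by (rule padic_rel_lim_eq[OF prime_card])

lemma padic_abs_Padic_const:
  "padic_abs (Padic (\<lambda>_. q) :: 'p::prime_card padic) = padic_abs_rat CARD('p) q"
proof -
  have "cr_padic (\<lambda>_. q) (Padic (\<lambda>_. q) :: 'p padic)"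
    by (simp add: cr_padic_def padic_rel_refl prime_card)
  hence "padic_abs (Padic (\<lambda>_. q) :: 'p padic) = lim (\<lambda>n. padic_abs_rat CARD('p) q)"
    using padic_abs.transfer unfolding padic.pcr_cr_eq rel_fun_def by fastforce
  thus ?thesis by simp
qed

lemma padic_abs_eq_0: "padic_abs x = 0 \<longleftrightarrow> x = (0 :: 'p::prime_card padic)"
proof (transfer, goal_cases)
  case (1 X)
  note l = padic_abs_tendsto_lim[OF prime_card 1]
  show ?case
    using l 1 by (auto simp: padic_rel_def padic_null_def prime_card intro: limI)
qed

lemma padic_abs_ultra: "padic_abs (x + y :: 'p::prime_card padic) \<le> max (padic_abs x) (padic_abs y)"
proof (transfer, goal_cases)
  case (1 X Y)
  note l = padic_abs_tendsto_lim[OF prime_card]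
  show ?case
    using l[OF padic_cauchy_add[OF prime_card 1]] tendsto_max[OF l[OF 1(1)] l[OF 1(2)]]
    by (rule LIMSEQ_le) (use padic_abs_rat_ultra[OF prime_card] in blast)
qed

lemma padic_abs_mult: "padic_abs (x * y :: 'p::prime_card padic) = padic_abs x * padic_abs y"
proof (transfer, goal_cases)
  case (1 X Y)
  note l = padic_abs_tendsto_lim[OF prime_card]
  show ?case
    using tendsto_mult[OF l[OF 1(1)] l[OF 1(2)]]
    by (intro limI) (simp add: padic_abs_rat_mult[OF prime_card])
qed

lemma padic_abs_minus: "padic_abs (- x) = padic_abs (x :: 'p::prime_card padic)"
  by transfer (simp add: prime_card)

lemma padic_abs_nonneg: "padic_abs (x :: 'p::prime_card padic) \<ge> 0"
  using padic_abs_ultra[of x "- x"] padic_abs_eq_0[of "0 :: 'p padic"] by (simp add: padic_abs_minus)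

instantiation padic :: (prime_card) metric_space
begin

definition dist_padic :: "'a padic \<Rightarrow> 'a padic \<Rightarrow> real" where
  "dist_padic x y = padic_abs (x - y)"

definition uniformity_padic :: "('a padic \<times> 'a padic) filter" where
  "uniformity_padic = (INF e\<in>{0 <..}. principal {(x, y). dist x y < e})"

definition open_padic :: "'a padic set \<Rightarrow> bool" where
  "open_padic U \<longleftrightarrow> (\<forall>x\<in>U. \<forall>\<^sub>F (x', y) in uniformity. x' = x \<longrightarrow> y \<in> U)"

instance
proof
  fix x y z :: "'a padic"
  show "uniformity = (INF e\<in>{0 <..}. principal {(x, y::'a padic). dist x y < e})"
    by (rule uniformity_padic_def)
  show "open U \<longleftrightarrow> (\<forall>x\<in>U. \<forall>\<^sub>F (x', y) in uniformity. x' = x \<longrightarrow> y \<in> U)" for U :: "'a padic set"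
    by (rule open_padic_def)
  show "dist x y = 0 \<longleftrightarrow> x = y" by (simp add: dist_padic_def padic_abs_eq_0)
  have "dist x y \<le> max (padic_abs (x - z)) (padic_abs (z - y))"
    using padic_abs_ultra[of "x - z" "z - y"] by (simp add: dist_padic_def)
  also have "padic_abs (z - y) = dist y z"
    unfolding dist_padic_def by (metis minus_diff_eq padic_abs_minus)
  also have "max (padic_abs (x - z)) (dist y z) \<le> dist x z + dist y z"
    using padic_abs_nonneg[of "x - z"] padic_abs_nonneg[of "y - z"] by (simp add: dist_padic_def)
  finally show "dist x y \<le> dist x z + dist y z" .
qed

end


section \<open>Haar measure, the Cesaro function space and the Hilbert operator\<close>

definition padic_haar :: "'p::prime_card padic measure \<Rightarrow> bool" where
  "padic_haar \<mu> \<longleftrightarrow>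
     sets \<mu> = sets borel \<and>
     (\<forall>a. \<forall>A\<in>sets borel. emeasure \<mu> ((+) a ` A) = emeasure \<mu> A) \<and>
     emeasure \<mu> {x. padic_abs x \<le> 1} = 1"

text \<open>Only used for exponents \<open>a > 0\<close>.\<close>

definition ennreal_powr :: "ennreal \<Rightarrow> real \<Rightarrow> ennreal" where
  "ennreal_powr x a = (if x = \<infinity> then \<infinity> else ennreal (enn2real x powr a))"

text \<open>In the norm, the integrand at the single point \<open>x = 0\<close>, a null set, is irrelevant.\<close>

definition cesaro_norm ::
  "'p::prime_card padic measure \<Rightarrow> real \<Rightarrow> ('p padic \<Rightarrow> complex) \<Rightarrow> ennreal" where
  "cesaro_norm M r f =
     ennreal_powr
       (\<integral>\<^sup>+x. ennreal_powr
               ((\<integral>\<^sup>+y\<in>{y. padic_abs y \<le> padic_abs x}. ennreal (norm (f y)) \<partial>M)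
                  / ennreal (padic_abs x)) r \<partial>M)
       (1 / r)"

definition cesaro_space ::
  "'p::prime_card padic measure \<Rightarrow> real \<Rightarrow> ('p padic \<Rightarrow> complex) set" where
  "cesaro_space M r = {f. f \<in> borel_measurable M \<and> cesaro_norm M r f < \<infinity>}"

text \<open>The operator is meant for \<open>x \<noteq> 0\<close>; the value at \<open>x = 0\<close> is irrelevant.\<close>

definition padic_hilbert ::
  "'p::prime_card padic measure \<Rightarrow> ('p padic \<Rightarrow> complex) \<Rightarrow> 'p padic \<Rightarrow> complex" where
  "padic_hilbert M f x =
     (LINT y:- {0}|M. f y / complex_of_real (padic_abs x + padic_abs y))"

definition hilbert_const :: "nat \<Rightarrow> real \<Rightarrow> real" where
  "hilbert_const p r =
     (1 - 1 / real p) *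
     (\<Sum>\<^sub>\<infinity>j::int. real p powr (of_int j * (1 - 1 / r)) / (1 + real p powr of_int j))"

end

theory Submission
  imports Defs
begin

text \<open>
  Neither the mean of \<open>|f|\<close> over the ball of radius \<open>|x|\<close> nor the value of the operator at \<open>x\<close>
  depends on more than \<open>|x|\<close>: both are constant on the spheres \<open>S\<^sub>k = {x. |x| = p\<^sup>k}\<close>. The claim
  therefore reduces to an inequality for sequences indexed by the integers. Write \<open>F(m)\<close> for the integral of \<open>|f|\<close> over
  \<open>S\<^sub>m\<close>, and \<open>T(k) = p\<^bsup>-k\<^esup> \<Sum>\<^bsub>m \<le> k\<^esub> F(m)\<close> for the mean of \<open>|f|\<close> over the ball of radius \<open>p\<^sup>k\<close>. As
  \<open>S\<^sub>k\<close> has measure \<open>w(k) = (1 - 1/p) p\<^sup>k\<close>, the norm of \<open>f\<close> is the \<open>r\<close>-th root of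
  \<open>\<Sum>\<^sub>k w(k) T(k)\<^sup>r\<close> (\<open>cesaro_norm_eq\<close>). On \<open>S\<^sub>k\<close> the operator is bounded by
  \<open>G(k) = \<Sum>\<^sub>l F(l) / (p\<^sup>k + p\<^sup>l)\<close>.
  
  The heart of the matter is that averaging commutes with the operator: the substitution
  \<open>l = m + j\<close> shows that the mean of \<open>G\<close> over the ball of radius \<open>p\<^sup>k\<close> is exactly
  \<open>\<Sum>\<^sub>j a(j) T(k + j)\<close> with \<open>a(j) = (1 - 1/p) p\<^sup>j / (1 + p\<^sup>j)\<close> (\<open>partial_mean_hilbert\<close>). Shifting \<open>T\<close> by
  \<open>j\<close> multiplies its weighted \<open>l\<^sup>r\<close> norm by \<open>p\<^bsup>-j/r\<^esup>\<close>, so Minkowski's inequality gives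
  the constant \<open>\<Sum>\<^sub>j a(j) p\<^bsup>-j/r\<^esup>\<close>, which is the stated one. As the shifted
  sequences agree up to these known factors in norm, the needed case of Minkowski's inequality follows here from Jensen's inequality for \<open>t \<mapsto> t\<^sup>r\<close> (\<open>shift_minkowski\<close>,
  \<open>nn_integral_powr_le\<close>).
  
  All sums are taken in the extended nonnegative reals, so the estimate holds before any
  convergence is known. Convergence of the integral defining the operator is then a consequence: the
  estimate bounds a weighted sum of the \<open>r\<close>-th powers of the means of \<open>G\<close>, every sphere has positive
  measure, and hence every \<open>G(k)\<close> is finite (\<open>hilbert_sum_finite\<close>).
  
  The only input about Haar measure is that the ball of radius \<open>p\<^sup>k\<close> has measure \<open>p\<^sup>k\<close>
  (\<open>haar_padic_ball\<close>). This is translation invariance together with the fact that a ball is the disjoint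
  union of \<open>p\<close> translates of the next smaller one (\<open>padic_ball_Suc\<close>).
\<close>

section \<open>The value group and the residue field\<close>

lift_definition padic_of_rat :: "rat \<Rightarrow> 'p::prime_card padic" is "\<lambda>q n. q"
  by (intro padic_rel_refl padic_cauchy_const prime_card)

lemma padic_of_rat_diff: "padic_of_rat (a - b) = (padic_of_rat a - padic_of_rat b :: 'p::prime_card padic)"
  by transfer (simp add: padic_rel_refl prime_card padic_cauchy_const)

lemma padic_abs_of_rat [simp]:
  "padic_abs (padic_of_rat q :: 'p::prime_card padic) = padic_abs_rat CARD('p) q"
  by transfer simp

text \<open>
  A term of a representing Cauchy sequence, taken far enough out, is close to the limit. All
  arithmetic facts about \<open>p\<close>-adic numbers below are reduced to rational ones in this way.
\<close>

lemma padic_of_rat_dense: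
  fixes x :: "'p::prime_card padic"
  assumes "e > 0"
  obtains q where "padic_abs (x - padic_of_rat q) < e"
proof -
  have "\<exists>q. padic_abs (x - padic_of_rat q) < e"
    using assms
  proof (transfer, goal_cases)
    case (1 e X)
    obtain N where N: "\<forall>m\<ge>N. \<forall>n\<ge>N. padic_abs_rat CARD('p) (X m - X n) < e / 2"
      using padic_cauchyD[OF prime_card, of X "e / 2"] 1 by auto
    have "(\<lambda>n. padic_abs_rat CARD('p) (X n - X N)) \<longlonglongrightarrow> lim (\<lambda>n. padic_abs_rat CARD('p) (X n - X N))"
      using 1 by (intro padic_abs_tendsto_lim[OF prime_card] padic_cauchy_diff[OF prime_card]
          padic_cauchy_const[OF prime_card])
    hence "lim (\<lambda>n. padic_abs_rat CARD('p) (X n - X N)) \<le> e / 2"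
      by (rule LIMSEQ_le_const2) (use N in \<open>auto intro!: exI[of _ N] less_imp_le\<close>)
    thus ?case using 1 by (intro exI[of _ "X N"]) auto
  qed
  thus ?thesis using that by blast
qed

lemma padic_abs_commute: "padic_abs (x - y) = padic_abs (y - x :: 'p::prime_card padic)"
  by (metis minus_diff_eq padic_abs_minus)

lemma padic_abs_add_le:
  assumes "padic_abs x \<le> c" "padic_abs y \<le> c"
  shows "padic_abs (x + y :: 'p::prime_card padic) \<le> c"
  using padic_abs_ultra[of x y] assms by simp

lemma padic_abs_diff_le:
  assumes "padic_abs x \<le> c" "padic_abs y \<le> c"
  shows "padic_abs (x - y :: 'p::prime_card padic) \<le> c"
  using padic_abs_add_le[of x c "- y"] assms by (simp add: padic_abs_minus)

lemma CARD_gt_1: "real CARD('p::prime_card) > 1"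
  using p_gt_1[OF prime_card] .

text \<open>
  A rational closer to \<open>x\<close> than \<open>|x|\<close> has the same absolute value as \<open>x\<close>, by the ultrametric
  inequality, so completing the rationals creates no new absolute values.
\<close>

lemma padic_abs_eq_powi:
  fixes x :: "'p::prime_card padic"
  assumes "x \<noteq> 0"
  obtains k where "padic_abs x = real CARD('p) powi k"
proof -
  have pos: "padic_abs x > 0"
    using assms padic_abs_nonneg[of x] padic_abs_eq_0[of x] by simp
  obtain q where q: "padic_abs (x - padic_of_rat q) < padic_abs x"
    using padic_of_rat_dense[OF pos] .
  have "padic_abs x \<le> max (padic_abs (x - padic_of_rat q)) (padic_abs (padic_of_rat q :: 'p padic))"
    using padic_abs_ultra[of "x - padic_of_rat q" "padic_of_rat q"] by simp
  moreover have "padic_abs (padic_of_rat q :: 'p padic) \<le> max (padic_abs (padic_of_rat q - x)) (padic_abs x)"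
    using padic_abs_ultra[of "padic_of_rat q - x" x] by simp
  ultimately have "padic_abs x = padic_abs_rat CARD('p) q"
    using q by (simp add: padic_abs_commute[of _ x])
  moreover have "q \<noteq> 0" using calculation pos by (auto simp: padic_abs_rat_def)
  ultimately show ?thesis using that by (simp add: padic_abs_rat_def)
qed

lemma padic_abs_rat_of_int_le:
  assumes p: "prime p" and "int p dvd a"
  shows "padic_abs_rat p (of_int a) \<le> 1 / real p"
proof (cases "a = 0")
  case False
  have "\<not> is_unit (int p)" using prime_elem_p[OF p] prime_elem_def by blast
  hence "multiplicity (int p) a \<ge> 1"
    using False assms by (intro multiplicity_geI) auto
  hence "real p powi (- int (multiplicity (int p) a)) \<le> real p powi (-1)"
    using p_gt_1[OF p] by (intro power_int_increasing) auto
  thus ?thesis using False padic_abs_rat_Fract[OF p, of a 1]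
    by (simp add: power_int_minus divide_inverse of_int_rat)
qed (simp add: padic_abs_rat_def)

lemma padic_abs_rat_of_int_unit:
  assumes p: "prime p" and "\<not> int p dvd a"
  shows "padic_abs_rat p (of_int a) = 1"
proof -
  have "a \<noteq> 0" using assms by auto
  thus ?thesis using padic_abs_rat_Fract[OF p, of a 1] not_dvd_imp_multiplicity_0[OF assms(2)]
    by (simp add: of_int_rat)
qed

lemma padic_abs_rat_p:
  assumes p: "prime p" shows "padic_abs_rat p (of_nat p powi k) = real p powi (- k)"
proof -
  have 1: "padic_abs_rat p (of_nat p) = 1 / real p"
    using padic_abs_rat_Fract[OF p, of "int p" 1] p prime_elem_p[OF p] prime_gt_0_nat[OF p]
    by (simp add: of_nat_rat power_int_minus divide_inverse prime_elem_not_unit multiplicity_same_power)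
  have 2: "padic_abs_rat p (of_nat p ^ n) = (1 / real p) ^ n" for n
    by (induction n) (simp_all add: padic_abs_rat_mult[OF p] 1 padic_abs_rat_1[OF p])
  show ?thesis
  proof (cases "k \<ge> 0")
    case True
    thus ?thesis by (simp add: power_int_def 2 power_one_over inverse_eq_divide)
  next
    case False
    thus ?thesis
      by (simp add: power_int_def padic_abs_rat_inverse[OF p] 2 power_inverse power_one_over)
  qed
qed

text \<open>
  The residue field has at most \<open>p\<close> elements: the denominator of a \<open>p\<close>-integral fraction \<open>a / b\<close> is prime
  to \<open>p\<close>, and \<open>i\<close> is chosen with \<open>i b \<equiv> a\<close> modulo \<open>p\<close>.
\<close>

lemma padic_abs_rat_residue:
  assumes p: "prime p" and "padic_abs_rat p u \<le> 1"
  obtains i where "i < p" "padic_abs_rat p (u - of_nat i) \<le> 1 / real p"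
proof -
  obtain a b where ab: "quotient_of u = (a, b)" by fastforce
  have b: "b > 0" using ab by (rule quotient_of_denom_pos)
  have cop: "coprime a b" using ab by (rule quotient_of_coprime)
  have u: "u = of_int a / of_int b" using ab by (rule quotient_of_div)
  have nb: "\<not> int p dvd b"
  proof
    assume db: "int p dvd b"
    have "\<not> is_unit (int p)" using prime_elem_p[OF p] prime_elem_def by blast
    hence "\<not> int p dvd a" using cop db by (metis coprime_common_divisor)
    hence "padic_abs_rat p (of_int a) = 1" by (rule padic_abs_rat_of_int_unit[OF p])
    moreover have "padic_abs_rat p (of_int a) = padic_abs_rat p u * padic_abs_rat p (of_int b)"
      using u b by (simp flip: padic_abs_rat_mult[OF p])
    moreover have "\<dots> \<le> 1 * (1 / real p)"
      using assms padic_abs_rat_of_int_le[OF p db] padic_abs_rat_nonneg[OF p] by (intro mult_mono) auto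
    ultimately show False using p_gt_1[OF p] by simp
  qed
  hence "coprime b (int p)" using prime_elem_p[OF p]
    by (metis coprime_commute prime_elem_imp_coprime)
  then obtain c where c: "[b * c = 1] (mod int p)" using cong_solve_coprime_int by blast
  define i where "i = nat ((a * c) mod int p)"
  have i: "int i = (a * c) mod int p" "i < p"
    using prime_gt_0_nat[OF p] by (auto simp: i_def nat_less_iff)
  have "[int i * b = (a * c) * b] (mod int p)" unfolding i(1) by (intro cong_mult) (auto simp: cong_def)
  also have "(a * c) * b = a * (b * c)" by simp
  also have "[a * (b * c) = a * 1] (mod int p)" by (intro cong_mult c) auto
  finally have dv: "int p dvd a - int i * b" by (simp add: cong_iff_dvd_diff dvd_diff_commute)
  have "(u - of_nat i) * of_int b = of_int (a - int i * b)" using u b by (simp add: field_simps)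
  hence "padic_abs_rat p (u - of_nat i) * padic_abs_rat p (of_int b) \<le> 1 / real p"
    using padic_abs_rat_of_int_le[OF p dv] by (simp flip: padic_abs_rat_mult[OF p])
  thus ?thesis using that i(2) padic_abs_rat_of_int_unit[OF p nb] by simp
qed

section \<open>Balls, spheres and their Haar measure\<close>

definition padic_ball :: "int \<Rightarrow> 'p::prime_card padic set" where
  "padic_ball k = {x. padic_abs x \<le> real CARD('p) powi k}"

definition padic_sphere :: "int \<Rightarrow> 'p::prime_card padic set" where
  "padic_sphere k = {x. padic_abs x = real CARD('p) powi k}"

text \<open>
  Multiplication by \<open>p\<^bsup>k+1\<^esup>\<close> turns the ball of radius \<open>p\<^bsup>k+1\<^esup>\<close> into the unit ball and the one of radius
  \<open>p\<^sup>k\<close> into its maximal ideal, so the translates correspond to the \<open>p\<close> residue classes.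
\<close>

lemma padic_ball_Suc:
  "(padic_ball (k + 1) :: 'p::prime_card padic set) =
     (\<Union>i<CARD('p). (+) (padic_of_rat (of_nat i * of_nat CARD('p) powi (- (k + 1)))) ` padic_ball k)"
    (is "_ = (\<Union>i<_. (+) (?c i) ` _)")
  and disjoint_padic_balls:
  "disjoint_family_on (\<lambda>i. (+) (padic_of_rat (of_nat i * of_nat CARD('p) powi (- (k + 1)))) `
     (padic_ball k :: 'p padic set)) {..<CARD('p)}"
proof -
  let ?p = "real CARD('p)" and ?P = "of_nat CARD('p) :: rat"
  note p = prime_card[where 'a='p] and pgt = CARD_gt_1[where 'p='p]
  have P0: "?P \<noteq> 0" by simp
  \<comment> \<open>absolute values after rescaling by \<open>p\<^bsup>k+1\<^esup>\<close>\<close>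
  have ab: "padic_abs_rat CARD('p) (u * ?P powi (- (k + 1))) = padic_abs_rat CARD('p) u * ?p powi (k + 1)" for u
    by (simp add: padic_abs_rat_mult[OF p] padic_abs_rat_p[OF p] algebra_simps)
  have le1: "padic_abs_rat CARD('p) (of_int i) \<le> 1" for i
    using padic_abs_rat_of_int_le[OF p, of i] padic_abs_rat_of_int_unit[OF p, of i] pgt
    by (cases "int CARD('p) dvd i") (auto intro: order_trans)
  have mono: "?p powi k \<le> ?p powi (k + 1)" using pgt by (intro power_int_increasing) auto
  show "(padic_ball (k + 1) :: 'p padic set) = (\<Union>i<CARD('p). (+) (?c i) ` padic_ball k)"
  proof (intro equalityI subsetI)
    fix x :: "'p padic" assume x: "x \<in> padic_ball (k + 1)"
    have "?p powi k > 0" using pgt by simp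
    then obtain q where q: "padic_abs (x - padic_of_rat q) < ?p powi k"
      using padic_of_rat_dense by blast
    have "padic_abs (x - (x - padic_of_rat q)) \<le> ?p powi (k + 1)"
      by (rule padic_abs_diff_le) (use x q mono in \<open>auto simp: padic_ball_def\<close>)
    hence qle: "padic_abs_rat CARD('p) q \<le> ?p powi (k + 1)" by simp
    \<comment> \<open>rescale to the unit ball, where the residue class \<open>i\<close> can be read off\<close>
    define u where "u = q * ?P powi (k + 1)"
    have qu: "q = u * ?P powi (- (k + 1))" using P0 by (simp add: u_def mult.assoc flip: power_int_add)
    have "padic_abs_rat CARD('p) u \<le> 1" using qle pgt unfolding qu ab by simp
    then obtain i where i: "i < CARD('p)" "padic_abs_rat CARD('p) (u - of_nat i) \<le> 1 / ?p"
      using padic_abs_rat_residue[OF p] by blast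
    have "padic_abs (padic_of_rat q - ?c i) = padic_abs_rat CARD('p) (u - of_nat i) * ?p powi (k + 1)"
      by (simp only: qu padic_of_rat_diff[symmetric] left_diff_distrib[symmetric] padic_abs_of_rat ab)
    also have "\<dots> \<le> (1 / ?p) * ?p powi (k + 1)" using i pgt by (intro mult_right_mono) auto
    also have "\<dots> = ?p powi k" using pgt by (simp add: power_int_add)
    finally have "padic_abs ((x - padic_of_rat q) + (padic_of_rat q - ?c i)) \<le> ?p powi k"
      using q by (intro padic_abs_add_le) auto
    hence "x - ?c i \<in> padic_ball k" by (simp add: padic_ball_def)
    hence "x \<in> (+) (?c i) ` padic_ball k" by (rule rev_image_eqI) simp
    thus "x \<in> (\<Union>i<CARD('p). (+) (?c i) ` padic_ball k)" using i by blast
  next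
    fix x :: "'p padic" assume "x \<in> (\<Union>i<CARD('p). (+) (?c i) ` padic_ball k)"
    then obtain i y where y: "x = ?c i + y" "y \<in> padic_ball k" by blast
    have "padic_abs (?c i :: 'p padic) \<le> 1 * ?p powi (k + 1)"
      unfolding padic_abs_of_rat ab using le1[of "int i"] pgt by (intro mult_right_mono) auto
    thus "x \<in> padic_ball (k + 1)"
      using y mono unfolding padic_ball_def by (auto intro!: padic_abs_add_le)
  qed
  show "disjoint_family_on (\<lambda>i. (+) (?c i) ` (padic_ball k :: 'p padic set)) {..<CARD('p)}"
    unfolding disjoint_family_on_def
  proof (intro ballI impI equals0I)
    fix i j x assume ij: "i \<in> {..<CARD('p)}" "j \<in> {..<CARD('p)}" "i \<noteq> j"
      and "x \<in> (+) (?c i) ` (padic_ball k :: 'p padic set) \<inter> (+) (?c j) ` padic_ball k"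
    then obtain y z :: "'p padic" where yz: "y \<in> padic_ball k" "z \<in> padic_ball k" "?c i + y = ?c j + z"
      by auto
    hence "?c i - ?c j = z - y" by (simp add: algebra_simps)
    hence le: "padic_abs (?c i - ?c j :: 'p padic) \<le> ?p powi k"
      using yz by (auto simp: padic_ball_def intro: padic_abs_diff_le)
    have eq: "?c i - ?c j = (padic_of_rat (of_int (int i - int j) * ?P powi (- (k + 1))) :: 'p padic)"
      by (simp only: padic_of_rat_diff[symmetric] left_diff_distrib of_int_diff of_int_of_nat_eq)
    have unit: "padic_abs_rat CARD('p) (of_int (int i - int j)) = 1"
    proof (rule padic_abs_rat_of_int_unit[OF p])
      show "\<not> int CARD('p) dvd int i - int j"
        using ij zdvd_not_zless[of "\<bar>int i - int j\<bar>" "int CARD('p)"] by auto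
    qed
    have "?p powi (k + 1) \<le> ?p powi k"
      using le unfolding eq padic_abs_of_rat ab unit by simp
    moreover have "?p powi k < ?p powi (k + 1)" using pgt by (intro power_int_strict_increasing) auto
    ultimately show False by simp
  qed
qed

lemma padic_ball_eq_cball: "padic_ball k = cball (0 :: 'p::prime_card padic) (real CARD('p) powi k)"
  by (auto simp: padic_ball_def dist_padic_def padic_abs_minus)

lemma plus_padic_ball_eq_cball: "(+) a ` padic_ball k = cball (a :: 'p::prime_card padic) (real CARD('p) powi k)"
proof (intro equalityI subsetI)
  fix x assume "x \<in> cball a (real CARD('p) powi k)"
  hence "x - a \<in> padic_ball k" by (simp add: padic_ball_def dist_padic_def padic_abs_commute)
  thus "x \<in> (+) a ` padic_ball k" by (rule rev_image_eqI) simp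
qed (auto simp: padic_ball_def dist_padic_def padic_abs_minus)

lemma borel_padic_ball [measurable]: "padic_ball k \<in> sets (borel :: 'p::prime_card padic measure)"
  by (simp add: padic_ball_eq_cball)

text \<open>
  Starting from the unit ball, the decomposition into \<open>p\<close> translates multiplies or divides the
  measure by \<open>p\<close> at each step, in both directions.
\<close>

lemma haar_padic_ball:
  fixes \<mu> :: "'p::prime_card padic measure"
  assumes "padic_haar \<mu>"
  shows "emeasure \<mu> (padic_ball k) = ennreal (real CARD('p) powi k)"
proof -
  note pgt = CARD_gt_1[where 'p='p]
  have sets: "sets \<mu> = sets borel" using assms by (simp add: padic_haar_def)
  have step: "emeasure \<mu> (padic_ball (k + 1)) = of_nat CARD('p) * emeasure \<mu> (padic_ball k)" for k
  proof -
    let ?A = "\<lambda>i. (+) (padic_of_rat (of_nat i * of_nat CARD('p) powi (- (k + 1)))) ` padic_ball k :: 'p padic set"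
    have "emeasure \<mu> (padic_ball (k + 1)) = emeasure \<mu> (\<Union>i<CARD('p). ?A i)"
      by (simp only: padic_ball_Suc)
    also have "\<dots> = (\<Sum>i<CARD('p). emeasure \<mu> (?A i))"
      by (intro sum_emeasure[symmetric] disjoint_padic_balls) (auto simp: sets plus_padic_ball_eq_cball)
    also have "\<dots> = (\<Sum>i<CARD('p). emeasure \<mu> (padic_ball k))"
      using assms by (intro sum.cong) (auto simp: padic_haar_def)
    finally show ?thesis by simp
  qed
  show ?thesis
  proof (induction k rule: int_induct[where k = 0])
    case base thus ?case using assms by (simp add: padic_haar_def padic_ball_def)
  next
    case (step1 i)
    thus ?case using pgt by (simp add: step power_int_add ennreal_mult' mult.commute flip: ennreal_of_nat_eq_real_of_nat)
  next
    case (step2 i)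
    have "of_nat CARD('p) * emeasure \<mu> (padic_ball (i - 1)) = ennreal (real CARD('p) powi i)"
      using step[of "i - 1"] step2 by simp
    also have "\<dots> = of_nat CARD('p) * ennreal (real CARD('p) powi (i - 1))"
      using pgt by (simp add: power_int_diff ennreal_of_nat_eq_real_of_nat flip: ennreal_mult')
    finally show ?case
      by (subst (asm) ennreal_mult_cancel_left) (auto simp: of_nat_less_top)
  qed
qed

text \<open>
  This is where discreteness of the value group enters: no absolute value lies strictly between
  \<open>p\<^bsup>k-1\<^esup>\<close> and \<open>p\<^sup>k\<close>.
\<close>

lemma padic_sphere_eq_Diff:
  "padic_sphere k = padic_ball k - (padic_ball (k - 1) :: 'p::prime_card padic set)"
proof (intro equalityI subsetI)
  fix x :: "'p padic"
  note p = CARD_gt_1[where 'p='p]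
  assume x: "x \<in> padic_ball k - padic_ball (k - 1)"
  hence "padic_abs x > real CARD('p) powi (k - 1)" by (simp add: padic_ball_def)
  moreover have "real CARD('p) powi (k - 1) > 0" using p by simp
  ultimately have "padic_abs x \<noteq> 0" by linarith
  hence "x \<noteq> 0" using padic_abs_eq_0[of x] by simp
  then obtain m where m: "padic_abs x = real CARD('p) powi m" by (rule padic_abs_eq_powi)
  hence "m = k"
    using x p power_int_strict_increasing[of k m "real CARD('p)"]
      power_int_increasing[of m "k - 1" "real CARD('p)"]
    by (cases m k rule: linorder_cases) (auto simp: padic_ball_def)
  thus "x \<in> padic_sphere k" using m by (simp add: padic_sphere_def)
qed (use CARD_gt_1[where 'p='p] power_int_strict_increasing[of "k - 1" k "real CARD('p)"]
     in \<open>auto simp: padic_sphere_def padic_ball_def\<close>)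

lemma borel_padic_sphere [measurable]: "padic_sphere k \<in> sets (borel :: 'p::prime_card padic measure)"
  unfolding padic_sphere_eq_Diff by measurable

lemma in_padic_sphere_iff_eq:
  assumes "x \<in> padic_sphere m"
  shows "(x :: 'p::prime_card padic) \<in> padic_sphere k \<longleftrightarrow> k = m"
  using assms CARD_gt_1[where 'p='p] power_int_strict_increasing[of k m "real CARD('p)"]
    power_int_strict_increasing[of m k "real CARD('p)"]
  by (cases m k rule: linorder_cases) (auto simp: padic_sphere_def)

lemma in_padic_ball_iff_le:
  assumes "x \<in> padic_sphere m"
  shows "(x :: 'p::prime_card padic) \<in> padic_ball k \<longleftrightarrow> m \<le> k"
  using assms CARD_gt_1[where 'p='p] power_int_strict_increasing[of k m "real CARD('p)"]
    power_int_increasing[of m k "real CARD('p)"]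
  by (auto simp: padic_sphere_def padic_ball_def not_le[symmetric])

lemma nonzero_in_padic_sphere:
  assumes "x \<noteq> (0 :: 'p::prime_card padic)"
  obtains k where "x \<in> padic_sphere k"
  using padic_abs_eq_powi[OF assms] by (auto simp: padic_sphere_def)

lemma zero_not_in_padic_sphere: "(0 :: 'p::prime_card padic) \<notin> padic_sphere k"
  using CARD_gt_1[where 'p='p] padic_abs_eq_0[of "0 :: 'p padic"] by (auto simp: padic_sphere_def)


section \<open>Jensen's inequality for powers\<close>

lemma ennreal_powr_ennreal: "x \<ge> 0 \<Longrightarrow> ennreal_powr (ennreal x) a = ennreal (x powr a)"
  by (simp add: ennreal_powr_def)

lemma ennreal_powr_top [simp]: "ennreal_powr top_class.top a = top_class.top"
  by (simp add: ennreal_powr_def)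

lemma ennreal_powr_0 [simp]: "ennreal_powr 0 a = 0"
  by (simp add: ennreal_powr_def)

lemma ennreal_powr_mono: "a > 0 \<Longrightarrow> x \<le> y \<Longrightarrow> ennreal_powr x a \<le> ennreal_powr y a"
  by (cases x; cases y) (auto simp: ennreal_powr_ennreal top_unique intro!: ennreal_leI powr_mono2)

lemma ennreal_powr_eq_0_iff [simp]: "ennreal_powr x a = 0 \<longleftrightarrow> x = 0"
  by (cases x) (auto simp: ennreal_powr_ennreal)

lemma ennreal_powr_eq_top_iff [simp]: "ennreal_powr x a = top_class.top \<longleftrightarrow> x = top_class.top"
  by (cases x) (auto simp: ennreal_powr_ennreal)

lemma ennreal_powr_less_top_iff [simp]: "ennreal_powr x a < top_class.top \<longleftrightarrow> x < top_class.top"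
  by (simp flip: less_top)

lemma ennreal_powr_mult: "ennreal_powr (x * y) a = ennreal_powr x a * ennreal_powr y a"
proof -
  consider "x = 0" | "y = 0" | "x \<noteq> 0" "y \<noteq> 0" "x = top_class.top \<or> y = top_class.top"
    | u v where "x = ennreal u" "y = ennreal v" "u \<ge> 0" "v \<ge> 0"
    by (cases x; cases y) auto
  thus ?thesis
  proof cases
    case 3
    thus ?thesis by (auto simp: ennreal_mult_top ennreal_top_mult)
  next
    case 4
    thus ?thesis by (simp add: ennreal_powr_ennreal powr_mult flip: ennreal_mult)
  qed auto
qed

lemma borel_measurable_ennreal_powr [measurable (raw)]:
  assumes [measurable]: "f \<in> borel_measurable M"
  shows "(\<lambda>x. ennreal_powr (f x) a) \<in> borel_measurable M"
  unfolding ennreal_powr_def by measurable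

text \<open>
  Jensen's inequality on a finite measure space, valid whether or not the integrals converge. The
  convex function \<open>t \<mapsto> t\<^sup>r\<close> lies above its tangent at \<open>l\<close>, where \<open>l\<^sup>r\<close> is the average of \<open>f\<^sup>r\<close>; solving
  the tangent inequality for \<open>t\<close> and integrating shows that the integral of \<open>f\<close> is at most \<open>l b\<close>.
\<close>

lemma nn_integral_powr_le:
  assumes [measurable]: "f \<in> borel_measurable N" and r: "r > 1"
    and N: "emeasure N (space N) = ennreal b"
  shows "ennreal_powr (\<integral>\<^sup>+x. f x \<partial>N) r \<le> ennreal (b powr (r - 1)) * (\<integral>\<^sup>+x. ennreal_powr (f x) r \<partial>N)"
proof -
  define I where "I = (\<integral>\<^sup>+x. ennreal_powr (f x) r \<partial>N)"
  have zero: ?thesis if "AE x in N. f x = 0"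
  proof -
    have "(\<integral>\<^sup>+x. f x \<partial>N) = (\<integral>\<^sup>+x. 0 \<partial>N)" using that by (rule nn_integral_cong_AE)
    thus ?thesis by simp
  qed
  consider "b \<le> 0" | "I = 0" | "b > 0" "I = top_class.top" | i where "b > 0" "i > 0" "I = ennreal i"
  proof (cases "b \<le> 0 \<or> I = 0 \<or> I = top_class.top")
    case True
    thus ?thesis using that(1-3) by fastforce
  next
    case False
    moreover then obtain i where "I = ennreal i" "i \<ge> 0" by (cases I) auto
    ultimately show ?thesis using that(4)[of i] by (cases "i = 0") auto
  qed
  thus ?thesis
  proof cases
    case 1
    hence "emeasure N (space N) = 0" using N by (simp add: ennreal_neg)
    hence "AE x in N. False" by (intro AE_I[of _ _ "space N"]) auto
    thus ?thesis by (intro zero) auto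
  next
    case 2
    hence "AE x in N. f x = 0" unfolding I_def by (subst (asm) nn_integral_0_iff_AE) auto
    thus ?thesis by (rule zero)
  next
    case 3
    thus ?thesis unfolding I_def by (simp add: ennreal_mult_top)
  next
    case (4 i)
    define l where "l = (i / b) powr (1 / r)"
    have l: "l > 0" "l powr r = i / b" using 4 r by (simp_all add: l_def powr_powr)
    define c where "c = l powr (1 - r) / r"
    have c: "c > 0" using l r by (simp add: c_def)
    \<comment> \<open>Young's inequality for the product of \<open>t / l\<close> and 1\<close>
    have tangent: "f x \<le> ennreal c * ennreal_powr (f x) r + ennreal ((1 - 1 / r) * l)" for x
    proof (cases "f x")
      case (real t)
      have "(t / l) * 1 \<le> (t / l) powr r / r + 1 powr (r / (r - 1)) / (r / (r - 1))"
        using real l r by (intro Youngs_inequality) (auto simp: field_simps)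
      also have "\<dots> = (t powr r / l powr r) / r + (1 - 1 / r)"
        using real l r by (simp add: powr_divide field_simps)
      finally have "t \<le> l * ((t powr r / l powr r) / r + (1 - 1 / r))"
        using l by (simp add: field_simps)
      also have "\<dots> = c * t powr r + (1 - 1 / r) * l"
        using l(1) r by (simp add: c_def powr_diff field_simps)
      finally show ?thesis using real c l r
        by (simp add: ennreal_powr_ennreal flip: ennreal_mult ennreal_plus)
    next
      case top
      thus ?thesis using c by (simp add: ennreal_mult_top)
    qed
    have "(\<integral>\<^sup>+x. f x \<partial>N) \<le> (\<integral>\<^sup>+x. ennreal c * ennreal_powr (f x) r + ennreal ((1 - 1 / r) * l) \<partial>N)"
      by (intro nn_integral_mono tangent)
    also have "\<dots> = ennreal c * I + ennreal ((1 - 1 / r) * l) * ennreal b"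
      by (simp add: nn_integral_add nn_integral_cmult I_def N)
    also have "\<dots> = ennreal (c * i + (1 - 1 / r) * l * b)"
      using 4 c l r by (simp flip: ennreal_mult ennreal_plus)
    also have "c * i = l * b / r"
    proof -
      have "c * i = l / (l powr r) * i / r" using l(1) by (simp add: c_def powr_diff)
      thus ?thesis using 4 l by (simp add: field_simps)
    qed
    also have "l * b / r + (1 - 1 / r) * l * b = l * b" using r by (simp add: field_simps)
    finally have "ennreal_powr (\<integral>\<^sup>+x. f x \<partial>N) r \<le> ennreal_powr (ennreal (l * b)) r"
      using r by (intro ennreal_powr_mono) auto
    also have "\<dots> = ennreal (i / b * b powr r)"
      using l 4 by (simp add: ennreal_powr_ennreal powr_mult)
    also have "i / b * b powr r = b powr (r - 1) * i"
      using 4 by (simp add: powr_diff)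
    also have "ennreal \<dots> = ennreal (b powr (r - 1)) * I" using 4 by (simp flip: ennreal_mult)
    finally show ?thesis by (simp add: I_def)
  qed
qed

section \<open>The inequality for sequences on the integers\<close>

lemma nn_integral_int_shift:
  fixes f :: "int \<Rightarrow> ennreal"
  shows "(\<integral>\<^sup>+m. f (m + j) \<partial>count_space UNIV) = (\<integral>\<^sup>+m. f m \<partial>count_space UNIV)"
  by (rule nn_integral_bij_count_space) (rule bij_betwI[of _ _ _ "\<lambda>m. m - j"]; simp)

lemma nn_integral_int_swap:
  fixes f :: "int \<Rightarrow> int \<Rightarrow> ennreal"
  shows "(\<integral>\<^sup>+j. \<integral>\<^sup>+k. f j k \<partial>count_space UNIV \<partial>count_space UNIV) =
     (\<integral>\<^sup>+k. \<integral>\<^sup>+j. f j k \<partial>count_space UNIV \<partial>count_space UNIV)"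
  by (rule nn_integral_count_space_nn_integral) auto

text \<open>
  If \<open>F m\<close> is the integral of a function over the sphere of radius \<open>q\<^sup>m\<close>, this is its mean over the ball of
  radius \<open>q\<^sup>k\<close>. Multiplying by \<open>q\<^bsup>-k\<^esup>\<close> instead of dividing by \<open>q\<^sup>k\<close> lets the factor move freely through
  sums of extended reals.
\<close>

definition partial_mean :: "real \<Rightarrow> (int \<Rightarrow> ennreal) \<Rightarrow> int \<Rightarrow> ennreal" where
  "partial_mean q F k =
     (\<integral>\<^sup>+m. F m * indicator {..k} m \<partial>count_space UNIV) * ennreal (q powi (- k))"

text \<open>
  The kernel \<open>1 / (q\<^sup>m + q\<^sup>l)\<close> is homogeneous: for \<open>l = m + j\<close> it is \<open>q\<^bsup>-m\<^esup> / (1 + q\<^sup>j)\<close>, and the factor \<open>q\<^bsup>-m\<^esup>\<close>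
  cancels against the measure of the sphere. What remains depends on \<open>m\<close> only through \<open>F (m + j)\<close>, so
  for each \<open>j\<close> the sum over \<open>m \<le> k\<close> is the partial sum of \<open>F\<close> up to \<open>k + j\<close>.
\<close>

lemma partial_mean_hilbert:
  assumes q: "q > 1"
  shows "partial_mean q (\<lambda>m. ennreal ((1 - 1 / q) * q powi m) *
             (\<integral>\<^sup>+l. F l * ennreal (1 / (q powi m + q powi l)) \<partial>count_space UNIV)) k =
     (\<integral>\<^sup>+j. ennreal ((1 - 1 / q) * (q powi j / (1 + q powi j))) * partial_mean q F (k + j)
        \<partial>count_space UNIV)"
proof -
  define c where "c = (\<lambda>j. ennreal ((1 - 1 / q) * q powi (- k) / (1 + q powi j)))"
  have pos: "q powi n > 0" "q powi n \<ge> 0" "q powi n \<noteq> 0" "q \<noteq> 0" "1 - 1 / q \<ge> 0" for n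
    using q by auto
  have c1: "ennreal ((1 - 1 / q) * q powi m) * ennreal (1 / (q powi m + q powi (j + m))) * ennreal (q powi (- k)) = c j" for m j
  proof -
    have "(1 - 1 / q) * q powi m * (1 / (q powi m + q powi (j + m))) * q powi (- k) =
        (1 - 1 / q) * q powi (- k) * (q powi m / (q powi m * (1 + q powi j)))"
      using pos by (simp add: power_int_add algebra_simps)
    also have "q powi m / (q powi m * (1 + q powi j)) = 1 / (1 + q powi j)" using pos by simp
    finally show ?thesis using pos
      by (simp add: c_def add_nonneg_nonneg flip: ennreal_mult)
  qed
  have c2: "ennreal ((1 - 1 / q) * (q powi j / (1 + q powi j))) * ennreal (q powi (- (k + j))) = c j" for j
  proof -
    have "(1 - 1 / q) * (q powi j / (1 + q powi j)) * q powi (- (k + j)) =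
        (1 - 1 / q) / (1 + q powi j) * (q powi j * q powi (- (k + j)))" by simp
    also have "q powi j * q powi (- (k + j)) = q powi (- k)" using pos by (simp flip: power_int_add)
    finally show ?thesis using pos by (simp add: c_def add_nonneg_nonneg flip: ennreal_mult)
  qed
  let ?I = "\<lambda>f :: int \<Rightarrow> ennreal. \<integral>\<^sup>+m. f m \<partial>count_space UNIV"
  have "?I (\<lambda>j. c j * (F (j + m) * indicator {..k} m)) = ennreal ((1 - 1 / q) * q powi m) *
      ?I (\<lambda>l. F l * ennreal (1 / (q powi m + q powi l))) * indicator {..k} m * ennreal (q powi (- k))"
    (is "_ = ?w * _ * ?i * ?Q") for m
  proof -
    have "?I (\<lambda>l. F l * ennreal (1 / (q powi m + q powi l))) =
        ?I (\<lambda>j. F (j + m) * ennreal (1 / (q powi m + q powi (j + m))))"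
      by (rule nn_integral_int_shift[symmetric])
    moreover have "c j * (F (j + m) * ?i) =
        ?w * ?i * ?Q * (F (j + m) * ennreal (1 / (q powi m + q powi (j + m))))" for j
      unfolding c1[symmetric, of j m] by (simp only: mult_ac)
    moreover have "?I (\<lambda>j. ?w * ?i * ?Q * (F (j + m) * ennreal (1 / (q powi m + q powi (j + m))))) =
        ?w * ?i * ?Q * ?I (\<lambda>j. F (j + m) * ennreal (1 / (q powi m + q powi (j + m))))"
      by (rule nn_integral_cmult) simp
    ultimately show ?thesis by (simp only: mult_ac)
  qed
  hence "partial_mean q (\<lambda>m. ennreal ((1 - 1 / q) * q powi m) *
             ?I (\<lambda>l. F l * ennreal (1 / (q powi m + q powi l)))) k =
      ?I (\<lambda>m. ?I (\<lambda>j. c j * (F (j + m) * indicator {..k} m)))"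
    unfolding partial_mean_def by (simp add: nn_integral_multc)
  also have "\<dots> = ?I (\<lambda>j. ?I (\<lambda>m. c j * (F (j + m) * indicator {..k} m)))"
    by (rule nn_integral_int_swap)
  also have "\<dots> = ?I (\<lambda>j. ?I (\<lambda>m. c j * (F (m + j) * indicator {..k + j} (m + j))))"
    by (simp add: add.commute indicator_def)
  also have "\<dots> = ?I (\<lambda>j. c j * ?I (\<lambda>m. F m * indicator {..k + j} m))"
    by (subst nn_integral_int_shift) (simp add: nn_integral_cmult)
  also have "\<dots> = ?I (\<lambda>j. ennreal ((1 - 1 / q) * (q powi j / (1 + q powi j))) * partial_mean q F (k + j))"
    unfolding c2[symmetric] partial_mean_def by (simp add: mult_ac)
  finally show ?thesis .
qed

text \<open>
  With respect to the weights \<open>s q\<^sup>k\<close>, the sequence \<open>q\<^bsup>j/r\<^esup> T (k + j)\<close> has the same \<open>l\<^sup>r\<close> norm as \<open>T\<close>.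
  The combination of the shifts of \<open>T\<close> with coefficients \<open>a j\<close> is thus a combination of sequences of equal norm with
  coefficients \<open>a j q\<^bsup>-j/r\<^esup>\<close> of total mass \<open>C\<close>. Apply Jensen's inequality for these masses at each \<open>k\<close>
  and sum over \<open>k\<close>.
\<close>

lemma shift_minkowski:
  fixes a :: "int \<Rightarrow> real" and T :: "int \<Rightarrow> ennreal"
  assumes q: "q > 1" and r: "r > 1" and a: "\<And>j. a j \<ge> 0" and s: "s \<ge> 0"
    and C: "C \<ge> 0" "(\<integral>\<^sup>+j. ennreal (a j * q powr (- of_int j / r)) \<partial>count_space UNIV) = ennreal C"
  shows "(\<integral>\<^sup>+k. ennreal (s * q powi k) *
            ennreal_powr (\<integral>\<^sup>+j. ennreal (a j) * T (k + j) \<partial>count_space UNIV) r \<partial>count_space UNIV)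
     \<le> ennreal (C powr r) * (\<integral>\<^sup>+k. ennreal (s * q powi k) * ennreal_powr (T k) r \<partial>count_space UNIV)"
proof -
  let ?I = "\<lambda>f :: int \<Rightarrow> ennreal. \<integral>\<^sup>+m. f m \<partial>count_space UNIV"
  define b where "b = (\<lambda>j::int. a j * q powr (- of_int j / r))"
  define N where "N = density (count_space UNIV) (\<lambda>j. ennreal (b j))"
  have Cb: "?I (\<lambda>j. ennreal (b j)) = ennreal C" using C by (simp add: b_def)
  have b: "b j \<ge> 0" for j using a by (simp add: b_def)
  have NI: "(\<integral>\<^sup>+j. f j \<partial>N) = ?I (\<lambda>j. ennreal (b j) * f j)" for f
    unfolding N_def by (rule nn_integral_density) auto
  have N: "emeasure N (space N) = ennreal C"
    using C NI[of "\<lambda>_. 1"] by (simp add: b_def)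
  define g where "g = (\<lambda>k j. ennreal (q powr (of_int j / r)) * T (k + j))"
  have ag: "ennreal (a j) * T (k + j) = ennreal (b j) * g k j" for k j
    using a q by (simp add: b_def g_def mult.assoc[symmetric] flip: ennreal_mult)
      (simp add: mult.assoc flip: powr_add)
  have gr: "ennreal_powr (g k j) r = ennreal (q powi j) * ennreal_powr (T (k + j)) r" for k j
    using q r by (simp add: g_def ennreal_powr_mult ennreal_powr_ennreal powr_powr powr_real_of_int')
  have "?I (\<lambda>k. ennreal (s * q powi k) * ennreal_powr (?I (\<lambda>j. ennreal (a j) * T (k + j))) r)
      \<le> ?I (\<lambda>k. ennreal (s * q powi k) * (ennreal (C powr (r - 1)) *
           ?I (\<lambda>j. ennreal (b j) * ennreal_powr (g k j) r)))"
    unfolding ag NI[symmetric]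
    by (intro nn_integral_mono mult_left_mono nn_integral_powr_le r N) (auto simp: N_def)
  also have "\<dots> = ?I (\<lambda>k. ?I (\<lambda>j. ennreal (C powr (r - 1)) * (ennreal (b j) *
      (ennreal (s * q powi (k + j)) * ennreal_powr (T (k + j)) r))))"
    using s q by (simp add: gr power_int_add ennreal_mult mult_ac flip: nn_integral_cmult)
  also have "\<dots> = ?I (\<lambda>j. ?I (\<lambda>k. ennreal (C powr (r - 1)) * (ennreal (b j) *
      (ennreal (s * q powi (k + j)) * ennreal_powr (T (k + j)) r))))"
    by (rule nn_integral_int_swap)
  also have "\<dots> = ?I (\<lambda>j. ?I (\<lambda>k. ennreal (C powr (r - 1)) * (ennreal (b j) *
      (ennreal (s * q powi k) * ennreal_powr (T k) r))))"
    by (subst nn_integral_int_shift) (rule refl)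
  also have "\<dots> = ennreal (C powr (r - 1)) * (ennreal C * ?I (\<lambda>k. ennreal (s * q powi k) * ennreal_powr (T k) r))"
    by (simp add: nn_integral_cmult nn_integral_multc Cb)
  also have "ennreal (C powr (r - 1)) * (ennreal C * X) = ennreal (C powr r) * X" for X
  proof -
    have "C powr (r - 1) * C = C powr r" using C by (cases "C = 0") (simp_all add: powr_diff)
    thus ?thesis using C by (simp add: mult.assoc[symmetric] flip: ennreal_mult)
  qed
  finally show ?thesis .
qed

lemma summable_on_powr_neg_nat:
  assumes "q > (1::real)" "e > 0"
  shows "(\<lambda>n::nat. q powr (- e * real n)) summable_on UNIV"
proof -
  have "summable (\<lambda>n. (q powr (- e)) ^ n)"
    using assms by (intro summable_geometric) (simp add: powr_less_one)
  thus ?thesis using assms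
    by (subst summable_on_UNIV_nonneg_real_iff) (simp_all add: powr_powr powr_realpow[symmetric])
qed

text \<open>
  The terms are bounded by \<open>q\<^bsup>-j/r\<^esup>\<close> for \<open>j \<ge> 0\<close> and by \<open>q\<^bsup>j(1-1/r)\<^esup>\<close> for \<open>j < 0\<close>, so both
  halves are dominated by geometric series; this uses \<open>r > 1\<close> on the negative side.
\<close>

lemma hilbert_const_summable:
  fixes q r :: real
  assumes q: "q > 1" and r: "r > 1"
  shows "(\<lambda>j::int. q powr (of_int j * (1 - 1 / r)) / (1 + q powr of_int j)) summable_on UNIV"
proof -
  let ?f = "\<lambda>j::int. q powr (of_int j * (1 - 1 / r)) / (1 + q powr of_int j)"
  have nonneg: "?f j \<ge> 0" for j by simp
  have "(?f \<circ> int) summable_on UNIV"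
  proof (rule summable_on_comparison_test[OF summable_on_powr_neg_nat[OF q, of "1 / r"]])
    fix n :: nat
    have "?f (int n) = q powr (real n * (1 - 1 / r)) / (1 + q powr real n)" by simp
    also have "\<dots> \<le> q powr (real n * (1 - 1 / r)) / q powr real n"
      using q by (intro divide_left_mono mult_pos_pos add_pos_pos) auto
    also have "\<dots> = q powr (- (1 / r) * real n)"
      by (simp add: algebra_simps flip: powr_diff)
    finally show "(?f \<circ> int) n \<le> q powr (- (1 / r) * real n)" by simp
  qed (use r nonneg in auto)
  hence 1: "?f summable_on range int" by (subst summable_on_reindex) auto
  have "(?f \<circ> (\<lambda>n. - int n - 1)) summable_on UNIV"
  proof (rule summable_on_comparison_test[OF summable_on_powr_neg_nat[OF q, of "1 - 1 / r"]])
    fix n :: nat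
    have "?f (- int n - 1) \<le> q powr (of_int (- int n - 1) * (1 - 1 / r)) / 1"
      by (intro divide_left_mono) (auto intro: add_pos_nonneg)
    also have "\<dots> \<le> q powr (- (1 - 1 / r) * real n)"
      using q r by (simp add: algebra_simps)
    finally show "(?f \<circ> (\<lambda>n. - int n - 1)) n \<le> q powr (- (1 - 1 / r) * real n)" by simp
  qed (use r nonneg in auto)
  hence 2: "?f summable_on range (\<lambda>n. - int n - 1)" by (subst summable_on_reindex) (auto simp: inj_on_def)
  have "range int \<union> range (\<lambda>n. - int n - 1) = UNIV"
  proof (intro equalityI subsetI)
    fix j :: int
    show "j \<in> range int \<union> range (\<lambda>n. - int n - 1)"
    proof (cases "j \<ge> 0")
      case True
      hence "j = int (nat j)" by simp
      thus ?thesis by blast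
    next
      case False
      hence "j = - int (nat (- j - 1)) - 1" by simp
      thus ?thesis by blast
    qed
  qed simp
  thus ?thesis using summable_on_union[OF 1 2] by simp
qed

text \<open>
  The total mass in \<open>shift_minkowski\<close>, for the coefficients of \<open>partial_mean_hilbert\<close>, is the constant of
  the theorem. Its definition is a sum of reals, which would be 0 if it diverged, so
  summability is what makes this an equation.
\<close>

lemma nn_integral_hilbert_const:
  assumes q: "real p > 1" and r: "r > 1"
  shows "(\<integral>\<^sup>+j. ennreal ((1 - 1 / real p) * (real p powi j / (1 + real p powi j)) * real p powr (- of_int j / r))
            \<partial>count_space UNIV) = ennreal (hilbert_const p r)"
    and "hilbert_const p r \<ge> 0"
proof -
  let ?f = "\<lambda>j::int. real p powr (of_int j * (1 - 1 / r)) / (1 + real p powr of_int j)"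
  have nonneg: "?f j \<ge> 0" for j by simp
  have "Infinite_Sum.abs_summable_on ?f UNIV"
    using hilbert_const_summable[OF assms] by (simp add: add_nonneg_nonneg abs_of_nonneg)
  hence abs: "Infinite_Set_Sum.abs_summable_on ?f UNIV" by (simp only: abs_summable_equivalent)
  have eq: "(1 - 1 / real p) * (real p powi j / (1 + real p powi j)) * real p powr (- of_int j / r) =
      (1 - 1 / real p) * ?f j" for j
  proof -
    have "real p powr (of_int j * (1 - 1 / r)) = real p powi j * real p powr (- of_int j / r)"
      using q by (simp add: algebra_simps powr_real_of_int'[symmetric] flip: powr_add)
    thus ?thesis using q by (simp add: powr_real_of_int')
  qed
  have "(\<integral>\<^sup>+j. ennreal ((1 - 1 / real p) * ?f j) \<partial>count_space UNIV) =
      ennreal (1 - 1 / real p) * (\<integral>\<^sup>+j. ennreal (?f j) \<partial>count_space UNIV)"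
    by (subst nn_integral_cmult[symmetric]) (use q nonneg in \<open>simp_all flip: ennreal_mult\<close>)
  also have "(\<integral>\<^sup>+j. ennreal (?f j) \<partial>count_space UNIV) = ennreal (infsum ?f UNIV)"
    using nn_integral_conv_infsetsum[OF abs] nonneg infsetsum_infsum[OF abs] by simp
  also have "ennreal (1 - 1 / real p) * \<dots> = ennreal (hilbert_const p r)"
    using q nonneg by (simp add: hilbert_const_def infsum_nonneg flip: ennreal_mult)
  finally show "(\<integral>\<^sup>+j. ennreal ((1 - 1 / real p) * (real p powi j / (1 + real p powi j)) *
      real p powr (- of_int j / r)) \<partial>count_space UNIV) = ennreal (hilbert_const p r)"
    by (simp only: eq)
  show "hilbert_const p r \<ge> 0"
    using q nonneg by (auto simp: hilbert_const_def intro!: mult_nonneg_nonneg infsum_nonneg)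
qed


section \<open>Integration over spheres\<close>

text \<open>
  The completion of Haar measure has more measurable sets than the Borel sets, and translation
  invariance enters only through the measure of balls. The locale therefore asks for no more than
  Borel sets being measurable and balls having the right measure. The parameter \<open>q\<close> stands for the prime as a
  real number.
\<close>

locale padic_ball_measure =
  fixes M :: "'p::prime_card padic measure" and q :: real
  assumes q_eq [simp]: "real CARD('p) = q"
    and sets_borel: "sets borel \<subseteq> sets M"
    and emeasure_ball: "emeasure M (padic_ball k) = ennreal (q powi k)"
begin

lemma q_gt_1: "q > 1"
  using CARD_gt_1[where 'p='p] by simp

lemma space_eq_UNIV [simp]: "space M = UNIV"
proof -
  have "UNIV \<in> sets M" using sets_borel sets.top[of borel] by auto
  thus ?thesis using sets.sets_into_space by blast
qed

lemma sets_ball [measurable]: "padic_ball k \<in> sets M"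
  using sets_borel borel_padic_ball by blast

lemma sets_sphere [measurable]: "padic_sphere k \<in> sets M"
  using sets_borel borel_padic_sphere by blast

lemma sets_zero [measurable]: "{0} \<in> sets M"
  using sets_borel by auto

lemma emeasure_sphere: "emeasure M (padic_sphere k) = ennreal ((1 - 1 / q) * q powi k)"
proof -
  have "q powi (k - 1) \<le> q powi k" using q_gt_1 by (intro power_int_increasing) auto
  hence "emeasure M (padic_sphere k) = ennreal (q powi k) - ennreal (q powi (k - 1))"
    unfolding padic_sphere_eq_Diff
    by (subst emeasure_Diff) (auto simp: emeasure_ball, auto simp: padic_ball_def)
  also have "\<dots> = ennreal (q powi k - q powi (k - 1))" using q_gt_1 by (intro ennreal_minus) simp
  also have "q powi k - q powi (k - 1) = (1 - 1 / q) * q powi k"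
    using q_gt_1 by (simp add: power_int_diff algebra_simps)
  finally show ?thesis .
qed

lemma emeasure_zero: "emeasure M {0} = 0"
proof (rule ccontr)
  assume nz: "emeasure M {0} \<noteq> 0"
  have le: "emeasure M {0} \<le> ennreal (q powi k)" for k
    unfolding emeasure_ball[symmetric] using q_gt_1
    by (intro emeasure_mono sets_ball) (auto simp: padic_ball_def padic_abs_eq_0[THEN iffD2])
  obtain e where e: "emeasure M {0} = ennreal e" "e > 0"
    using nz le[of 0] by (cases "emeasure M {0}") (auto simp: less_le top_unique)
  obtain n where "(1 / q) ^ n < e" using real_arch_pow_inv[of e "1 / q"] e q_gt_1 by auto
  moreover have "e \<le> q powi (- int n)" using le[of "- int n"] e q_gt_1 by simp
  ultimately show False by (simp add: power_int_minus power_one_over inverse_eq_divide)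
qed

lemma AE_nonzero: "AE x in M. x \<noteq> 0"
  using emeasure_zero by (intro AE_I[of _ _ "{0}"]) auto

text \<open>
  Apart from the point 0 there are only countably many spheres, so every preimage under a function
  constant on spheres is a countable union of spheres, possibly with 0 added.
\<close>

lemma radial_measurable:
  fixes g :: "'p padic \<Rightarrow> 'c::topological_space"
  assumes "\<And>x k. x \<in> padic_sphere k \<Longrightarrow> g x = \<phi> k"
  shows "g \<in> borel_measurable M"
proof (rule measurableI)
  fix B :: "'c set" assume "B \<in> sets borel"
  have "g -` B \<inter> space M = (if g 0 \<in> B then {0} else {}) \<union> (\<Union>k\<in>{k. \<phi> k \<in> B}. padic_sphere k)"
  proof (rule Set.set_eqI)
    fix x show "x \<in> g -` B \<inter> space M \<longleftrightarrow>
        x \<in> (if g 0 \<in> B then {0} else {}) \<union> (\<Union>k\<in>{k. \<phi> k \<in> B}. padic_sphere k)"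
    proof (cases "x = 0")
      case True thus ?thesis using zero_not_in_padic_sphere[where 'p='p] by auto
    next
      case False
      then obtain k where k: "x \<in> padic_sphere k" by (rule nonzero_in_padic_sphere)
      show ?thesis using False in_padic_sphere_iff_eq[OF k] assms[OF k] by auto
    qed
  qed
  also have "\<dots> \<in> sets M" by (intro sets.Un sets.countable_UN') auto
  finally show "g -` B \<inter> space M \<in> sets M" .
qed simp

lemma padic_abs_measurable [measurable]: "padic_abs \<in> borel_measurable M"
  by (rule radial_measurable[of _ "\<lambda>k. q powi k"]) (simp add: padic_sphere_def)

lemma nn_integral_spheres:
  assumes [measurable]: "g \<in> borel_measurable M"
  shows "(\<integral>\<^sup>+x. g x \<partial>M) = (\<integral>\<^sup>+k. (\<integral>\<^sup>+x\<in>padic_sphere k. g x \<partial>M) \<partial>count_space UNIV)"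
proof -
  have "g x = (\<integral>\<^sup>+k. g x * indicator (padic_sphere k) x \<partial>count_space UNIV)" if "x \<noteq> 0" for x
  proof -
    obtain m where m: "x \<in> padic_sphere m" using \<open>x \<noteq> 0\<close> by (rule nonzero_in_padic_sphere)
    have "(\<integral>\<^sup>+k. g x * indicator (padic_sphere k) x \<partial>count_space UNIV) =
        (\<integral>\<^sup>+k. g x * indicator {m} k \<partial>count_space UNIV)"
      by (simp add: indicator_def in_padic_sphere_iff_eq[OF m])
    thus ?thesis by (subst (asm) nn_integral_cmult_indicator) auto
  qed
  hence "(\<integral>\<^sup>+x. g x \<partial>M) = (\<integral>\<^sup>+x. (\<integral>\<^sup>+k. g x * indicator (padic_sphere k) x \<partial>count_space UNIV) \<partial>M)"
    using AE_nonzero by (intro nn_integral_cong_AE) auto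
  also have "\<dots> = (\<integral>\<^sup>+k. (\<integral>\<^sup>+x\<in>padic_sphere k. g x \<partial>M) \<partial>count_space UNIV)"
    by (rule nn_integral_count_space_nn_integral) auto
  finally show ?thesis .
qed

lemma nn_integral_radial:
  assumes "\<And>x k. x \<in> padic_sphere k \<Longrightarrow> g x = \<phi> k"
  shows "(\<integral>\<^sup>+x. g x \<partial>M) = (\<integral>\<^sup>+k. ennreal ((1 - 1 / q) * q powi k) * \<phi> k \<partial>count_space UNIV)"
proof -
  have "(\<integral>\<^sup>+x\<in>padic_sphere k. g x \<partial>M) = (\<integral>\<^sup>+x. \<phi> k * indicator (padic_sphere k) x \<partial>M)" for k
    using assms by (intro nn_integral_cong) (auto simp: indicator_def)
  hence "(\<integral>\<^sup>+x\<in>padic_sphere k. g x \<partial>M) = ennreal ((1 - 1 / q) * q powi k) * \<phi> k" for k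
    by (simp add: nn_integral_cmult_indicator emeasure_sphere mult.commute)
  thus ?thesis using nn_integral_spheres[OF radial_measurable[OF assms]] by simp
qed

section \<open>The Cesaro norm and the Hilbert operator in terms of spheres\<close>

definition sphere_integral :: "('p padic \<Rightarrow> complex) \<Rightarrow> int \<Rightarrow> ennreal" where
  "sphere_integral f k = (\<integral>\<^sup>+x\<in>padic_sphere k. ennreal (norm (f x)) \<partial>M)"

lemma cesaro_mean_eq_partial_mean:
  fixes x :: "'p padic"
  assumes [measurable]: "f \<in> borel_measurable M" and x: "x \<in> padic_sphere k"
  shows "(\<integral>\<^sup>+y\<in>{y. padic_abs y \<le> padic_abs x}. ennreal (norm (f y)) \<partial>M) / ennreal (padic_abs x) =
     partial_mean q (sphere_integral f) k"
proof -
  have ball: "{y :: 'p padic. padic_abs y \<le> padic_abs x} = padic_ball k"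
    using x by (simp add: padic_sphere_def padic_ball_def)
  have "(\<integral>\<^sup>+y\<in>padic_ball k. ennreal (norm (f y)) \<partial>M) =
      (\<integral>\<^sup>+m. (\<integral>\<^sup>+y\<in>padic_sphere m. ennreal (norm (f y)) * indicator (padic_ball k) y \<partial>M) \<partial>count_space UNIV)"
    by (rule nn_integral_spheres) measurable
  also have "\<dots> = (\<integral>\<^sup>+m. (\<integral>\<^sup>+y. ennreal (norm (f y)) * indicator (padic_sphere m) y * indicator {..k} m \<partial>M)
      \<partial>count_space UNIV)"
    by (intro nn_integral_cong) (auto simp: indicator_def in_padic_ball_iff_le)
  also have "\<dots> = (\<integral>\<^sup>+m. sphere_integral f m * indicator {..k} m \<partial>count_space UNIV)"
    unfolding sphere_integral_def by (subst nn_integral_multc) auto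
  finally have "(\<integral>\<^sup>+y\<in>padic_ball k. ennreal (norm (f y)) \<partial>M) =
      (\<integral>\<^sup>+m. sphere_integral f m * indicator {..k} m \<partial>count_space UNIV)" .
  moreover have "padic_abs x = q powi k" using x by (simp add: padic_sphere_def)
  ultimately show ?thesis unfolding ball
    using q_gt_1 by (simp add: partial_mean_def divide_ennreal_def inverse_ennreal power_int_minus)
qed

text \<open>
  The \<open>r\<close>-th power of the Cesaro norm, as a function of the integrals over spheres. It is also
  applied to sequences that do not arise from a finite-valued function.
\<close>

definition cesaro_sum :: "real \<Rightarrow> (int \<Rightarrow> ennreal) \<Rightarrow> ennreal" where
  "cesaro_sum r F = (\<integral>\<^sup>+k. ennreal ((1 - 1 / q) * q powi k) *
      ennreal_powr (partial_mean q F k) r \<partial>count_space UNIV)"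

lemma cesaro_norm_eq:
  assumes "f \<in> borel_measurable M"
  shows "cesaro_norm M r f = ennreal_powr (cesaro_sum r (sphere_integral f)) (1 / r)"
  unfolding cesaro_norm_def cesaro_sum_def
  by (subst nn_integral_radial) (simp_all add: cesaro_mean_eq_partial_mean[OF assms])

lemma cesaro_sum_mono:
  assumes "r > 0" "\<And>m. F m \<le> G m"
  shows "cesaro_sum r F \<le> cesaro_sum r G"
  unfolding cesaro_sum_def partial_mean_def using assms
  by (intro nn_integral_mono mult_mono ennreal_powr_mono) auto

definition hilbert_sum :: "('p padic \<Rightarrow> complex) \<Rightarrow> int \<Rightarrow> ennreal" where
  "hilbert_sum f k = (\<integral>\<^sup>+l. sphere_integral f l * ennreal (1 / (q powi k + q powi l)) \<partial>count_space UNIV)"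

lemma nn_integral_hilbert_kernel:
  fixes x :: "'p padic"
  assumes [measurable]: "f \<in> borel_measurable M" and x: "x \<in> padic_sphere k"
  shows "(\<integral>\<^sup>+y. ennreal (norm (f y / complex_of_real (padic_abs x + padic_abs y))) \<partial>M) = hilbert_sum f k"
proof -
  have pos: "q powi n > 0" for n using q_gt_1 by simp
  have kernel: "ennreal (norm (f y / complex_of_real (padic_abs x + padic_abs y))) =
      ennreal (norm (f y)) * ennreal (1 / (q powi k + q powi l))" if "y \<in> padic_sphere l" for y l
  proof -
    have "norm (f y / complex_of_real (padic_abs x + padic_abs y)) = norm (f y) * (1 / (q powi k + q powi l))"
      using x that pos[of k] pos[of l] unfolding norm_divide norm_of_real by (simp add: padic_sphere_def)
    thus ?thesis using pos[of k] pos[of l] by (simp flip: ennreal_mult)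
  qed
  have "(\<integral>\<^sup>+y. ennreal (norm (f y / complex_of_real (padic_abs x + padic_abs y))) \<partial>M) =
      (\<integral>\<^sup>+l. (\<integral>\<^sup>+y\<in>padic_sphere l. ennreal (norm (f y / complex_of_real (padic_abs x + padic_abs y))) \<partial>M)
         \<partial>count_space UNIV)"
    by (rule nn_integral_spheres) measurable
  also have "\<dots> = (\<integral>\<^sup>+l. (\<integral>\<^sup>+y. ennreal (norm (f y)) * indicator (padic_sphere l) y *
      ennreal (1 / (q powi k + q powi l)) \<partial>M) \<partial>count_space UNIV)"
    by (intro nn_integral_cong) (auto simp: indicator_def kernel simp del: of_real_add)
  also have "\<dots> = hilbert_sum f k"
    unfolding hilbert_sum_def sphere_integral_def by (subst nn_integral_multc) auto
  finally show ?thesis .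
qed

lemma set_integrable_hilbert_kernel:
  fixes x :: "'p padic"
  assumes f [measurable]: "f \<in> borel_measurable M" and x: "x \<in> padic_sphere k" and "hilbert_sum f k < \<infinity>"
  shows "set_integrable M (- {0}) (\<lambda>y. f y / complex_of_real (padic_abs x + padic_abs y))"
proof -
  have [measurable]: "- {0} \<in> sets M" using sets.compl_sets[OF sets_zero] by (simp add: Compl_eq_Diff_UNIV)
  have "integrable M (\<lambda>y. f y / complex_of_real (padic_abs x + padic_abs y))"
    using assms(3) nn_integral_hilbert_kernel[OF f x] by (intro integrableI_bounded) auto
  thus ?thesis unfolding set_integrable_def by (intro integrable_mult_indicator) auto
qed

text \<open>
  If the defining integral does not converge, the value of the operator is 0 by convention, so that the
  bound holds in that case too.
\<close>

lemma norm_padic_hilbert_le: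
  fixes x :: "'p padic"
  assumes f: "f \<in> borel_measurable M" and x: "x \<in> padic_sphere k"
  shows "ennreal (norm (padic_hilbert M f x)) \<le> hilbert_sum f k"
proof (cases "set_integrable M (- {0}) (\<lambda>y. f y / complex_of_real (padic_abs x + padic_abs y))")
  case True
  have "ennreal (norm (padic_hilbert M f x)) \<le>
      (\<integral>\<^sup>+y. norm (indicator (- {0}) y *\<^sub>R (f y / complex_of_real (padic_abs x + padic_abs y))) \<partial>M)"
    using True unfolding padic_hilbert_def set_lebesgue_integral_def set_integrable_def
    by (rule integral_norm_bound_ennreal)
  also have "\<dots> \<le> (\<integral>\<^sup>+y. ennreal (norm (f y / complex_of_real (padic_abs x + padic_abs y))) \<partial>M)"
    by (intro nn_integral_mono ennreal_leI) (auto simp: indicator_def)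
  finally show ?thesis using nn_integral_hilbert_kernel[OF f x] by simp
next
  case False
  thus ?thesis
    by (simp add: padic_hilbert_def set_lebesgue_integral_def set_integrable_def not_integrable_integral_eq)
qed

lemma padic_hilbert_measurable: "padic_hilbert M f \<in> borel_measurable M"
  by (rule radial_measurable[of _ "\<lambda>k. LINT y:- {0}|M. f y / complex_of_real (q powi k + padic_abs y)"])
     (simp add: padic_hilbert_def padic_sphere_def)

lemma sphere_integral_padic_hilbert_le:
  assumes "f \<in> borel_measurable M"
  shows "sphere_integral (padic_hilbert M f) m \<le> ennreal ((1 - 1 / q) * q powi m) * hilbert_sum f m"
proof -
  have "sphere_integral (padic_hilbert M f) m \<le> (\<integral>\<^sup>+x. hilbert_sum f m * indicator (padic_sphere m) x \<partial>M)"
    unfolding sphere_integral_def using norm_padic_hilbert_le[OF assms]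
    by (intro nn_integral_mono) (auto simp: indicator_def)
  thus ?thesis by (subst (asm) nn_integral_cmult_indicator) (simp_all add: emeasure_sphere mult.commute)
qed

lemma cesaro_sum_hilbert_le:
  assumes r: "r > 1"
  shows "cesaro_sum r (\<lambda>m. ennreal ((1 - 1 / q) * q powi m) * hilbert_sum f m)
     \<le> ennreal (hilbert_const CARD('p) r powr r) * cesaro_sum r (sphere_integral f)"
  unfolding cesaro_sum_def hilbert_sum_def partial_mean_hilbert[OF q_gt_1]
  using nn_integral_hilbert_const[OF CARD_gt_1[where 'p='p] r] q_gt_1 r
  by (intro shift_minkowski) (auto intro!: mult_nonneg_nonneg divide_nonneg_nonneg add_nonneg_nonneg)

text \<open>
  All terms of the Cesaro sum carry positive weights, and the mean at \<open>k\<close> contains the term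
  \<open>hilbert_sum f k\<close> with a positive factor, so finiteness passes from the sum to that term.
\<close>

lemma hilbert_sum_finite:
  assumes fin: "cesaro_sum r (\<lambda>m. ennreal ((1 - 1 / q) * q powi m) * hilbert_sum f m) < \<infinity>"
  shows "hilbert_sum f k < \<infinity>"
proof -
  let ?w = "\<lambda>k. ennreal ((1 - 1 / q) * q powi k)"
  have w: "?w k > 0" using q_gt_1 by simp
  have "?w k * ennreal_powr (partial_mean q (\<lambda>m. ?w m * hilbert_sum f m) k) r < \<infinity>"
    using fin unfolding cesaro_sum_def
    by (rule le_less_trans[rotated]) (rule nn_integral_ge_point[where p = "\<lambda>k. _ k * ennreal_powr (_ k) r"], simp)
  hence "partial_mean q (\<lambda>m. ?w m * hilbert_sum f m) k < \<infinity>"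
    using w by (auto simp: ennreal_mult_less_top)
  hence "(\<integral>\<^sup>+m. ?w m * hilbert_sum f m * indicator {..k} m \<partial>count_space UNIV) < \<infinity>"
    using q_gt_1 unfolding partial_mean_def by (auto simp: ennreal_mult_less_top)
  moreover have "?w k * hilbert_sum f k * indicator {..k} k \<le>
      (\<integral>\<^sup>+m. ?w m * hilbert_sum f m * indicator {..k} m \<partial>count_space UNIV)"
    by (rule nn_integral_ge_point) simp
  ultimately have "?w k * hilbert_sum f k < \<infinity>" by (simp add: le_less_trans)
  thus ?thesis using w by (auto simp: ennreal_mult_less_top)
qed

end

lemma padic_ball_measure_completion_haar:
  assumes "padic_haar \<mu>"
  shows "padic_ball_measure (completion \<mu> :: 'p::prime_card padic measure) (real CARD('p))"
proof
  have sets: "sets \<mu> = sets borel" using assms by (simp add: padic_haar_def)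
  show "real CARD('p) = real CARD('p)" ..
  show "sets borel \<subseteq> sets (completion \<mu>)" using sets by auto
  show "emeasure (completion \<mu>) (padic_ball k) = ennreal (real CARD('p) powi k)" for k
    using sets haar_padic_ball[OF assms, of k] by (simp add: main_part_sets)
qed

theorem theorem5p2:
  fixes \<mu> :: "'p::prime_card padic measure" and r :: real and f :: "'p padic \<Rightarrow> complex"
  assumes "padic_haar \<mu>" and "1 < r" and "f \<in> cesaro_space (completion \<mu>) r"
  shows "(\<forall>x::'p padic. x \<noteq> 0 \<longrightarrow> set_integrable (completion \<mu>) (- {0})
            (\<lambda>y. f y / complex_of_real (padic_abs x + padic_abs y))) \<and>
         padic_hilbert (completion \<mu>) f \<in> cesaro_space (completion \<mu>) r \<and>
         cesaro_norm (completion \<mu>) r (padic_hilbert (completion \<mu>) f)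
           \<le> ennreal (hilbert_const CARD('p) r) * cesaro_norm (completion \<mu>) r f"
proof -
  define q where "q = real CARD('p)"
  interpret padic_ball_measure "completion \<mu>" q
    unfolding q_def by (rule padic_ball_measure_completion_haar) fact
  let ?M = "completion \<mu>" and ?C = "hilbert_const CARD('p) r" and ?H = "padic_hilbert (completion \<mu>) f"
  let ?G = "\<lambda>m. ennreal ((1 - 1 / q) * q powi m) * hilbert_sum f m"
  have f: "f \<in> borel_measurable ?M" and fin: "cesaro_norm ?M r f < \<infinity>"
    using assms(3) by (auto simp: cesaro_space_def)
  have C: "?C \<ge> 0" using nn_integral_hilbert_const(2)[OF CARD_gt_1[where 'p='p] assms(2)] .
  have H: "?H \<in> borel_measurable ?M" by (rule padic_hilbert_measurable)
  have le: "cesaro_sum r ?G \<le> ennreal (?C powr r) * cesaro_sum r (sphere_integral f)"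
    by (rule cesaro_sum_hilbert_le) fact
  have "cesaro_sum r (sphere_integral f) < \<infinity>"
    using fin unfolding cesaro_norm_eq[OF f] by simp
  hence Gfin: "cesaro_sum r ?G < \<infinity>"
    by (intro le_less_trans[OF le]) (simp add: ennreal_mult_less_top)
  have int: "set_integrable ?M (- {0}) (\<lambda>y. f y / complex_of_real (padic_abs x + padic_abs y))"
    if "x \<noteq> 0" for x :: "'p padic"
  proof -
    obtain k where "x \<in> padic_sphere k" using \<open>x \<noteq> 0\<close> by (rule nonzero_in_padic_sphere)
    thus ?thesis by (intro set_integrable_hilbert_kernel f hilbert_sum_finite[OF Gfin])
  qed
  have "cesaro_norm ?M r ?H \<le> ennreal_powr (cesaro_sum r ?G) (1 / r)"
    unfolding cesaro_norm_eq[OF H] using assms(2)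
    by (intro ennreal_powr_mono cesaro_sum_mono sphere_integral_padic_hilbert_le f) auto
  also have "\<dots> \<le> ennreal_powr (ennreal (?C powr r) * cesaro_sum r (sphere_integral f)) (1 / r)"
    using assms(2) by (intro ennreal_powr_mono le) auto
  also have "\<dots> = ennreal ?C * cesaro_norm ?M r f"
    using C assms(2)
    by (simp add: ennreal_powr_mult ennreal_powr_ennreal powr_powr cesaro_norm_eq[OF f])
  finally have norm: "cesaro_norm ?M r ?H \<le> ennreal ?C * cesaro_norm ?M r f" .
  moreover have "cesaro_norm ?M r ?H < \<infinity>"
    using fin by (intro le_less_trans[OF norm]) (simp add: ennreal_mult_less_top)
  ultimately show ?thesis using int H by (auto simp: cesaro_space_def)
qed

end
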